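(* Suppose there is a function $f:[0,2]\times\mathbb{N}_{\ge1}\to[0,\infty)$ with $\lim_{\epsilon\to0}f(\epsilon,d)=0=f(0,d)$ for every $d$, such that for all finite-dimensional Hilbert spaces $\mathcal{H}_X,\mathcal{H}_Y$, all density operators $\rho,\sigma$ on $\mathcal{H}_X\otimes\mathcal{H}_Y$ and all $\epsilon\in[0,2]$ with $\|\rho-\sigma\|_1\le\epsilon$, $$\bigl|S(X|Y)_\rho-S(X|Y)_\sigma\bigr|\le f(\epsilon,\dim\mathcal{H}_X).$$ Then, for all finite-dimensional Hilbert spaces $\mathcal{H}_A,\mathcal{H}_B$, squashed entanglement $E_{sq}$ is a continuous function (with respect to the trace norm) on the set of all density operators on $\mathcal{H}_A\otimes\mathcal{H}_B$.
   Context: $\|\cdot\|_1$ is the trace norm. For a state $\rho$ on a tensor product of systems, $\rho^X$ denotes its reduced state on the subsystem $X$, and $S(X)=S(\rho^X)=-\operatorname{Tr}\rho^X\log\rho^X$ is the von Neumann entropy ($\log$ to base 2). The conditional von Neumann entropy of a state $\rho$ on $\mathcal{H}_X\otimes\mathcal{H}_Y$ is $S(X|Y)_\rho=S(\rho)-S(\rho^Y)$. For a tripartite state $\rho^{ABE}$ the quantum conditional mutual information is $I(A;B|E)=S(AE)+S(BE)-S(ABE)-S(E)$. The squashed entanglement of a state $\rho^{AB}$ on $\mathcal{H}_A\otimes\mathcal{H}_B$ is $$E_{sq}(\rho^{AB})=\inf\left\{\tfrac12 I(A;B|E)\;:\;\rho^{ABE}\text{ a state on }\mathcal{H}_A\otimes\mathcal{H}_B\otimes\mathcal{H}_E\text{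 with }\operatorname{Tr}_E\rho^{ABE}=\rho^{AB}\right\},$$ where the infimum is over all extensions $\rho^{ABE}$, with $\mathcal{H}_E$ of arbitrary (a priori unbounded) finite dimension. *)

theory Defs
  imports Complex_Main "Jordan_Normal_Form.Schur_Decomposition"
begin

text \<open>
  A Hilbert space of dimension \<open>d\<close> is \<open>\<complex>\<^sup>d\<close>, and an operator on it is a complex \<open>d \<times> d\<close> matrix.
  The basis vector \<open>e\<^sub>x \<otimes> e\<^sub>y\<close> of a tensor product with dimensions \<open>n, m\<close> has index \<open>x * m + y\<close>; with
  three factors of dimensions \<open>n, k, m\<close>, \<open>e\<^sub>x \<otimes> e\<^sub>y \<otimes> e\<^sub>z\<close> has index \<open>(x * k + y) * m + z\<close>, so that
  the tensor product is strictly associative.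
\<close>

definition mat_trace :: "complex mat \<Rightarrow> complex" where
  "mat_trace A = (\<Sum>i<dim_row A. A $$ (i, i))"

definition density_operator :: "nat \<Rightarrow> complex mat \<Rightarrow> bool" where
  "density_operator d \<rho> \<longleftrightarrow>
     \<rho> \<in> carrier_mat d d \<and> mat_adjoint \<rho> = \<rho> \<and>
     (\<forall>v \<in> carrier_vec d. 0 \<le> (\<rho> *\<^sub>v v) \<bullet>c v) \<and>
     mat_trace \<rho> = 1"

text \<open>
  Functional calculus: if \<open>A = U diag(r) U\<^sup>*\<close> with \<open>U\<close> unitary and \<open>r\<close> real, then the result is
  \<open>U diag(g \<circ> r) U\<^sup>*\<close>, which does not depend on the choice of \<open>U\<close> and \<open>r\<close>. It is only used for
  Hermitian \<open>A\<close>, where such a decomposition exists.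
\<close>

definition herm_fun :: "(real \<Rightarrow> real) \<Rightarrow> complex mat \<Rightarrow> complex mat" where
  "herm_fun g A = (let n = dim_row A in
     THE B. \<exists>U r. U \<in> carrier_mat n n \<and> mat_adjoint U * U = 1\<^sub>m n \<and>
       A = U * mat_diag n (\<lambda>i. complex_of_real (r i)) * mat_adjoint U \<and>
       B = U * mat_diag n (\<lambda>i. complex_of_real (g (r i))) * mat_adjoint U)"

text \<open>\<open>\<parallel>A\<parallel>\<^sub>1 = Tr \<surd>(A\<^sup>* A)\<close>; the trace is real.\<close>

definition trace_norm :: "complex mat \<Rightarrow> real" where
  "trace_norm A = Re (mat_trace (herm_fun sqrt (mat_adjoint A * A)))"

text \<open>
  \<open>- Tr \<rho> log \<rho>\<close>. In HOL \<open>log 2 0 = 0\<close>, so on the kernel of \<open>\<rho>\<close> the usual convention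
  \<open>0 log 0 = 0\<close> holds.
\<close>

definition entropy :: "complex mat \<Rightarrow> real" where
  "entropy \<rho> = - Re (mat_trace (\<rho> * herm_fun (log 2) \<rho>))"

text \<open>
  Trace over the middle factor of \<open>\<complex>\<^sup>n \<otimes> \<complex>\<^sup>k \<otimes> \<complex>\<^sup>m\<close>. The cases \<open>n = 1\<close> and \<open>m = 1\<close> are the
  traces over the first and the last factor of a bipartite system.
\<close>

definition partial_trace :: "nat \<Rightarrow> nat \<Rightarrow> nat \<Rightarrow> complex mat \<Rightarrow> complex mat" where
  "partial_trace n k m \<rho> = mat (n * m) (n * m) (\<lambda>(i, j).
     \<Sum>l<k. \<rho> $$ (((i div m) * k + l) * m + i mod m, ((j div m) * k + l) * m + j mod m))"

definition cond_entropy :: "nat \<Rightarrow> nat \<Rightarrow> complex mat \<Rightarrow> real" where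
  "cond_entropy dX dY \<rho> = entropy \<rho> - entropy (partial_trace 1 dX dY \<rho>)"

text \<open>\<open>I(A;B|E) = S(AE) + S(BE) - S(ABE) - S(E)\<close> for a state on \<open>A \<otimes> B \<otimes> E\<close>.\<close>

definition cond_mutual_info :: "nat \<Rightarrow> nat \<Rightarrow> nat \<Rightarrow> complex mat \<Rightarrow> real" where
  "cond_mutual_info dA dB dE \<rho> =
     entropy (partial_trace dA dB dE \<rho>) + entropy (partial_trace 1 dA (dB * dE) \<rho>)
     - entropy \<rho> - entropy (partial_trace 1 (dA * dB) dE \<rho>)"

text \<open>
  For a state \<open>\<rho>\<close> the set below is nonempty (trivial \<open>E\<close>) and bounded below by \<open>0\<close>
  (strong subadditivity), so the real-valued \<open>Inf\<close> is the true infimum.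
\<close>

definition squashed_entanglement :: "nat \<Rightarrow> nat \<Rightarrow> complex mat \<Rightarrow> real" where
  "squashed_entanglement dA dB \<rho> =
     Inf {1/2 * cond_mutual_info dA dB dE \<rho>' | dE \<rho>'.
            1 \<le> dE \<and> density_operator (dA * dB * dE) \<rho>' \<and>
            partial_trace (dA * dB) dE 1 \<rho>' = \<rho>}"

end

theory Submission
  imports Defs "Jordan_Normal_Form.Spectral_Radius"
begin

text \<open>
  Write an extension \<open>\<rho>\<^sup>A\<^sup>B\<^sup>E\<close> of \<open>\<rho>\<close> as \<open>M M\<^sup>*\<close>; regrouping the indices of \<open>M\<close> into \<open>AB\<close> against the rest
  gives \<open>\<Psi>\<close> with \<open>\<rho> = \<Psi> \<Psi>\<^sup>*\<close>. If \<open>\<Psi> = \<rho>\<^sup>1\<^sup>/\<^sup>2 V\<close> with a coisometry \<open>V\<close>, then \<open>\<Phi> = \<sigma>\<^sup>1\<^sup>/\<^sup>2 V\<close> yields in the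
  same way an extension of \<open>\<sigma>\<close>, on the same \<open>E\<close>. By the Powers-Stormer inequality the squared
  Hilbert-Schmidt distance of \<open>\<Psi>\<close> and \<open>\<Phi>\<close> is at most \<open>\<parallel>\<rho> - \<sigma>\<parallel>\<^sub>1\<close>, and it bounds the trace distance of the
  two extensions and of their marginals, independently of \<open>dim E\<close>. Since
  \<open>I(A;B|E) = S(A|E) - S(A|BE)\<close>, the assumed continuity bound, used twice with \<open>X = A\<close>, shows
  that their conditional mutual informations are close.
\<close>

subsection \<open>Diagonalization of Hermitian matrices\<close>

lemma index_mult_mat_sum:
  assumes "A \<in> carrier_mat n m" "B \<in> carrier_mat m p" "i < n" "j < p"
  shows "(A * B) $$ (i, j) = (\<Sum>k<m. A $$ (i, k) * B $$ (k, j))"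
  using assms by (simp add: scalar_prod_def atLeast0LessThan)

text \<open>With square factors the inner dimension is determined by the conclusion, so the
  simplifier can discharge carrier conditions without guessing it.\<close>

lemma mult_carrier_square [simp]:
  "A \<in> carrier_mat n n \<Longrightarrow> B \<in> carrier_mat n n \<Longrightarrow> A * B \<in> carrier_mat n n"
  by (rule mult_carrier_mat)

lemma mult_one_square [simp]:
  fixes A :: "'a :: semiring_1 mat"
  assumes "A \<in> carrier_mat n n"
  shows "1\<^sub>m n * A = A" "A * 1\<^sub>m n = A"
  using assms by (rule left_mult_one_mat, rule right_mult_one_mat)

lemma index_mat_adjoint [simp]:
  "i < dim_col A \<Longrightarrow> j < dim_row A \<Longrightarrow> mat_adjoint A $$ (i, j) = conjugate (A $$ (j, i))"
  by (simp add: mat_adjoint_def mat_of_rows_index)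

lemma dim_mat_adjoint [simp]:
  "dim_row (mat_adjoint A) = dim_col A" "dim_col (mat_adjoint A) = dim_row A"
  by (simp_all add: mat_adjoint_def)

lemma mat_adjoint_carrier [simp, intro]:
  "A \<in> carrier_mat n m \<Longrightarrow> mat_adjoint A \<in> carrier_mat m n"
  by (intro carrier_matI) simp_all

lemma mat_adjoint_adjoint [simp]:
  fixes A :: "complex mat"
  shows "mat_adjoint (mat_adjoint A) = A"
  by (rule eq_matI) auto

lemma mat_adjoint_mult:
  fixes A :: "complex mat"
  assumes "A \<in> carrier_mat n m" "B \<in> carrier_mat m p"
  shows "mat_adjoint (A * B) = mat_adjoint B * mat_adjoint A"
proof (rule eq_matI)
  fix i j assume "i < dim_row (mat_adjoint B * mat_adjoint A)" "j < dim_col (mat_adjoint B * mat_adjoint A)"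
  then have ij: "i < p" "j < n" using assms by auto
  then show "mat_adjoint (A * B) $$ (i, j) = (mat_adjoint B * mat_adjoint A) $$ (i, j)"
    using assms
    by (auto simp: index_mult_mat_sum[OF assms ij(2,1)] mult.commute
        index_mult_mat_sum[OF mat_adjoint_carrier[OF assms(2)] mat_adjoint_carrier[OF assms(1)] ij])
qed (use assms in auto)

section \<open>Unitary matrices and matrices diagonal in a unitary basis\<close>

definition unitary_mat :: "nat \<Rightarrow> complex mat \<Rightarrow> bool" where
  "unitary_mat n U \<longleftrightarrow> U \<in> carrier_mat n n \<and> mat_adjoint U * U = 1\<^sub>m n"

text \<open>The spectral form over which \<open>herm_fun\<close> quantifies. Only the values of
  \<open>r\<close> below \<open>n\<close> matter.\<close>

definition diag_conj :: "nat \<Rightarrow> complex mat \<Rightarrow> (nat \<Rightarrow> real) \<Rightarrow> complex mat" where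
  "diag_conj n U r = U * mat_diag n (\<lambda>i. complex_of_real (r i)) * mat_adjoint U"

lemma unitary_matD:
  assumes "unitary_mat n U"
  shows "U \<in> carrier_mat n n" "mat_adjoint U * U = 1\<^sub>m n" "U * mat_adjoint U = 1\<^sub>m n"
  using assms mat_mult_left_right_inverse[of "mat_adjoint U" n U] unfolding unitary_mat_def by auto

lemma unitary_mat_mult:
  assumes "unitary_mat n U" "unitary_mat n W"
  shows "unitary_mat n (U * W)"
proof -
  note U = unitary_matD[OF assms(1)] and W = unitary_matD[OF assms(2)]
  have "mat_adjoint (U * W) * (U * W) = mat_adjoint W * ((mat_adjoint U * U) * W)"
    using U(1) W(1) by (simp add: mat_adjoint_mult[OF U(1) W(1)] assoc_mult_mat[of _ n n _ n _ n]
      del: assoc_mult_mat)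
  then show ?thesis using U W by (simp add: unitary_mat_def)
qed

lemma unitary_mat_cols:
  assumes "unitary_mat n U" "i < n" "j < n"
  shows "(\<Sum>k<n. cnj (U $$ (k, i)) * U $$ (k, j)) = (if i = j then 1 else 0)"
proof -
  note U = unitary_matD[OF assms(1)]
  have "(mat_adjoint U * U) $$ (i, j) = (if i = j then 1 else 0)" using U assms by simp
  then show ?thesis
    using U(1) assms by (simp add: index_mult_mat_sum[of _ n n _ n] del: index_mult_mat(1))
qed

lemma unitary_mat_rows:
  assumes "unitary_mat n U" "i < n" "j < n"
  shows "(\<Sum>k<n. U $$ (i, k) * cnj (U $$ (j, k))) = (if i = j then 1 else 0)"
proof -
  note U = unitary_matD[OF assms(1)]
  have "(U * mat_adjoint U) $$ (i, j) = (if i = j then 1 else 0)" using U assms by simp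
  then show ?thesis
    using U(1) assms by (simp add: index_mult_mat_sum[of _ n n _ n] del: index_mult_mat(1))
qed

lemma unitary_matI_cols:
  assumes "U \<in> carrier_mat n n"
    and "\<And>i j. i < n \<Longrightarrow> j < n \<Longrightarrow> (\<Sum>k<n. cnj (U $$ (k, i)) * U $$ (k, j)) = (if i = j then 1 else 0)"
  shows "unitary_mat n U"
  unfolding unitary_mat_def
proof
  show "mat_adjoint U * U = 1\<^sub>m n"
    using assms by (intro eq_matI) (auto simp: index_mult_mat_sum[of _ n n _ n] simp del: index_mult_mat(1))
qed fact

lemma diag_conj_carrier [simp]: "U \<in> carrier_mat n n \<Longrightarrow> diag_conj n U r \<in> carrier_mat n n"
  by (auto simp: diag_conj_def)

lemma dim_diag_conj [simp]:
  "dim_row (diag_conj n U r) = dim_row U" "dim_col (diag_conj n U r) = dim_row U"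
  by (simp_all add: diag_conj_def)

lemma index_diag_conj:
  assumes "U \<in> carrier_mat n n" "i < n" "j < n"
  shows "diag_conj n U r $$ (i, j) = (\<Sum>k<n. U $$ (i, k) * of_real (r k) * cnj (U $$ (j, k)))"
  using assms unfolding diag_conj_def
  by (simp add: mat_diag_mult_right[of U n n] index_mult_mat_sum[of _ n n _ n] del: index_mult_mat(1))

lemma diag_conj_mult_left:
  assumes "U \<in> carrier_mat n n" "W \<in> carrier_mat n n"
  shows "diag_conj n (U * W) r = U * diag_conj n W r * mat_adjoint U"
  using assms
  by (simp add: diag_conj_def mat_adjoint_mult[OF assms] assoc_mult_mat[of _ n n _ n _ n]
      del: assoc_mult_mat)

lemma mat_adjoint_diag_conj:
  assumes "U \<in> carrier_mat n n"
  shows "mat_adjoint (diag_conj n U r) = diag_conj n U r"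
  using assms by (intro eq_matI) (auto simp: index_diag_conj mult_ac)

lemma diag_conj_mult:
  assumes "unitary_mat n U"
  shows "diag_conj n U r * diag_conj n U s = diag_conj n U (\<lambda>i. r i * s i)"
proof -
  note U = unitary_matD[OF assms]
  let ?D = "\<lambda>r. mat_diag n (\<lambda>i. complex_of_real (r i))"
  have "diag_conj n U r * diag_conj n U s = U * (?D r * ((mat_adjoint U * U) * (?D s * mat_adjoint U)))"
    using U(1) by (simp add: diag_conj_def assoc_mult_mat[of _ n n _ n _ n] del: assoc_mult_mat)
  also have "\<dots> = U * (?D r * ?D s) * mat_adjoint U"
    using U by (simp add: assoc_mult_mat[of _ n n _ n _ n] del: assoc_mult_mat mat_diag_diag)
  finally show ?thesis by (simp add: diag_conj_def)
qed

lemma conj_diag_conj: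
  assumes "unitary_mat n U"
  shows "mat_adjoint U * diag_conj n U r * U = mat_diag n (\<lambda>i. complex_of_real (r i))"
proof -
  note U = unitary_matD[OF assms]
  let ?D = "mat_diag n (\<lambda>i. complex_of_real (r i))"
  have "mat_adjoint U * diag_conj n U r * U = (mat_adjoint U * U) * (?D * (mat_adjoint U * U))"
    using U(1) by (simp add: diag_conj_def assoc_mult_mat[of _ n n _ n _ n] del: assoc_mult_mat)
  then show ?thesis using U by simp
qed

text \<open>Normalizing an orthogonal list gives orthonormal columns. The scalars \<open>c j\<close>
  are exposed so that a column can still be recognized as a multiple of a given eigenvector.\<close>

lemma orthogonal_basis_unitary:
  fixes ws :: "complex vec list"
  assumes ws: "set ws \<subseteq> carrier_vec n" "corthogonal ws" "length ws = n"
  obtains W c where "unitary_mat n W" "\<And>i j. i < n \<Longrightarrow> j < n \<Longrightarrow> W $$ (i, j) = c j * (ws ! j $ i)"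
proof -
  define q where "q j = Re ((ws ! j) \<bullet>c (ws ! j))" for j
  define c where "c j = complex_of_real (1 / sqrt (q j))" for j
  define W where "W = mat n n (\<lambda>(i, j). c j * (ws ! j $ i))"
  have car: "ws ! j \<in> carrier_vec n" if "j < n" for j using ws that by auto
  have ip: "(\<Sum>k<n. cnj (ws ! i $ k) * (ws ! j $ k)) = (if i = j then of_real (q i) else 0)"
    if "i < n" "j < n" for i j
  proof -
    have e: "(\<Sum>k<n. cnj (ws ! i $ k) * (ws ! j $ k)) = (ws ! j) \<bullet>c (ws ! i)"
      using car[OF that(1)] car[OF that(2)]
      by (auto simp: scalar_prod_def atLeast0LessThan mult.commute intro!: sum.cong)
    \<comment> \<open>Being nonnegative in the order on complex numbers includes having imaginary
      part zero, so taking \<open>Re\<close> in \<open>q\<close> loses nothing.\<close>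
    have "(ws ! i) \<bullet>c (ws ! i) = of_real (q i)"
    proof -
      have "0 \<le> (ws ! i) \<bullet>c (ws ! i)" by (rule conjugate_square_ge_0_vec)
      then show ?thesis unfolding q_def by (auto simp: less_eq_complex_def complex_eq_iff)
    qed
    then show ?thesis using e corthogonalD[OF ws(2), of j i] ws(3) that by auto
  qed
  have q: "q i > 0" if "i < n" for i
  proof -
    have "(ws ! i) \<bullet>c (ws ! i) \<noteq> 0" using corthogonalD[OF ws(2), of i i] ws(3) that by auto
    moreover have "0 \<le> (ws ! i) \<bullet>c (ws ! i)" by (rule conjugate_square_ge_0_vec)
    ultimately show ?thesis unfolding q_def by (auto simp: less_eq_complex_def complex_eq_iff)
  qed
  have "unitary_mat n W"
  proof (rule unitary_matI_cols)
    fix i j assume ij: "i < n" "j < n"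
    have "(\<Sum>k<n. cnj (W $$ (k, i)) * W $$ (k, j))
        = (\<Sum>k<n. c i * c j * (cnj (ws ! i $ k) * (ws ! j $ k)))"
      using ij by (intro sum.cong) (auto simp: W_def c_def mult_ac)
    also have "\<dots> = c i * c j * (if i = j then of_real (q i) else 0)"
      by (simp only: sum_distrib_left[symmetric] ip[OF ij])
    also have "\<dots> = (if i = j then 1 else 0)"
      using q[OF ij(1)] by (auto simp: c_def simp flip: of_real_mult)
    finally show "(\<Sum>k<n. cnj (W $$ (k, i)) * W $$ (k, j)) = (if i = j then 1 else 0)" .
  qed (simp add: W_def)
  then show ?thesis by (rule that[of W c]) (simp add: W_def)
qed

text \<open>Over the complex numbers an eigenvector exists. It is completed to a basis and
  orthogonalized; Gram-Schmidt keeps the first vector, and rescaling it leaves it an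
  eigenvector.\<close>

lemma unitary_eigenvector_first:
  fixes A :: "complex mat"
  assumes A: "A \<in> carrier_mat (Suc n) (Suc n)"
  obtains W e where "unitary_mat (Suc n) W"
    "\<And>i. i < Suc n \<Longrightarrow> (A * W) $$ (i, 0) = e * W $$ (i, 0)"
proof -
  let ?n = "Suc n"
  obtain e where "eigenvalue A e" using spectrum_non_empty[OF A] by (auto simp: spectrum_def)
  then obtain v where v: "v \<in> carrier_vec ?n" and v0: "v \<noteq> 0\<^sub>v ?n" and ev: "A *\<^sub>v v = e \<cdot>\<^sub>v v"
    using A unfolding eigenvalue_def eigenvector_def by auto
  interpret cof_vec_space ?n "TYPE(complex)" .
  define b where "b = basis_completion v"
  define ws where "ws = gram_schmidt ?n b"
  note bc = basis_completion[OF v v0, folded b_def]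
  note gs = gram_schmidt_result[OF bc(2,4,5) refl, folded ws_def]
  have ws: "set ws \<subseteq> carrier_vec ?n" "corthogonal ws" "length ws = ?n" using gs bc(6) by auto
  obtain vs where bv: "b = v # vs" using bc(6,7) by (cases b) auto
  have "hd ws = v" unfolding ws_def bv by (rule gram_schmidt_hd[OF v])
  then have w0: "ws ! 0 = v" using ws(3) by (cases ws) auto
  obtain W c where W: "unitary_mat ?n W"
    and Wi: "\<And>i j. i < ?n \<Longrightarrow> j < ?n \<Longrightarrow> W $$ (i, j) = c j * (ws ! j $ i)"
    using orthogonal_basis_unitary[OF ws] by metis
  show ?thesis
  proof (rule that[OF W])
    fix i assume i: "i < ?n"
    have "(\<Sum>k<?n. A $$ (i, k) * v $ k) = e * v $ i"
      using arg_cong[OF ev, of "\<lambda>x. x $ i"] A v i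
      by (simp add: scalar_prod_def atLeast0LessThan)
    then have "c 0 * (\<Sum>k<?n. A $$ (i, k) * v $ k) = c 0 * (e * v $ i)" by (simp only:)
    then show "(A * W) $$ (i, 0) = e * W $$ (i, 0)"
      using i Wi[of _ 0] unfolding index_mult_mat_sum[OF A unitary_matD(1)[OF W] i zero_less_Suc]
      by (simp add: w0 sum_distrib_left mult_ac del: sum.lessThan_Suc)
  qed
qed

text \<open>Deflation: in a unitary basis starting with an eigenvector, the first column is zero
  below its top entry. Hermiticity then clears the first row too, and the remaining block is
  Hermitian of size one less.\<close>

theorem hermitian_diagonalizable:
  fixes A :: "complex mat"
  assumes "A \<in> carrier_mat n n" "mat_adjoint A = A"
  obtains U r where "unitary_mat n U" "A = diag_conj n U r"
proof -
  have "\<exists>U r. unitary_mat n U \<and> A = diag_conj n U r"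
    using assms
  proof (induction n arbitrary: A)
    case 0
    then have "unitary_mat 0 (1\<^sub>m 0)" "A = diag_conj 0 (1\<^sub>m 0) (\<lambda>_. 0)"
      by (auto simp: unitary_mat_def)
    then show ?case by blast
  next
    case (Suc n)
    note A = Suc.prems(1)
    obtain W e where W: "unitary_mat (Suc n) W"
      and e: "\<And>i. i < Suc n \<Longrightarrow> (A * W) $$ (i, 0) = e * W $$ (i, 0)"
      using unitary_eigenvector_first[OF A] by metis
    note Wc = unitary_matD[OF W]
    define B where "B = mat_adjoint W * (A * W)"
    have B: "B \<in> carrier_mat (Suc n) (Suc n)" using A Wc by (auto simp: B_def)
    have Bh: "mat_adjoint B = B"
      unfolding B_def using A Wc Suc.prems(2)
      by (simp add: mat_adjoint_mult[of _ "Suc n" "Suc n" _ "Suc n"]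
          assoc_mult_mat[of _ "Suc n" "Suc n" _ "Suc n" _ "Suc n"] del: assoc_mult_mat)
    have Bsym: "B $$ (i, j) = cnj (B $$ (j, i))" if "i < Suc n" "j < Suc n" for i j
      using arg_cong[OF Bh, of "\<lambda>X. X $$ (i, j)"] B that by simp
    have B0: "B $$ (i, 0) = (if i = 0 then e else 0)" if i: "i < Suc n" for i
    proof -
      have "B $$ (i, 0) = (\<Sum>k<Suc n. cnj (W $$ (k, i)) * (e * W $$ (k, 0)))"
        unfolding B_def using Wc A i e
        by (subst index_mult_mat_sum[of _ "Suc n" "Suc n" _ "Suc n"])
           (auto simp del: index_mult_mat(1) sum.lessThan_Suc intro!: sum.cong)
      also have "\<dots> = e * (\<Sum>k<Suc n. cnj (W $$ (k, i)) * W $$ (k, 0))"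
        by (simp add: sum_distrib_left mult_ac del: sum.lessThan_Suc)
      finally show ?thesis using unitary_mat_cols[OF W i zero_less_Suc] by auto
    qed
    have B0': "B $$ (0, i) = (if i = 0 then e else 0)" if i: "i < Suc n" for i
      using Bsym[OF zero_less_Suc i] Bsym[of 0 0] B0[OF i] B0[of 0] by auto
    \<comment> \<open>The eigenvalue is a diagonal entry of the Hermitian matrix \<open>B\<close>,
      hence real.\<close>
    have eR: "of_real (Re e) = e" using Bsym[of 0 0] B0[of 0] by (auto simp: complex_eq_iff)
    define C where "C = mat n n (\<lambda>(i, j). B $$ (Suc i, Suc j))"
    have "mat_adjoint C = C"
      by (rule eq_matI) (auto simp: C_def intro: Bsym[symmetric])
    moreover have "C \<in> carrier_mat n n" by (simp add: C_def)
    ultimately obtain V s where V: "unitary_mat n V" and C: "C = diag_conj n V s"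
      using Suc.IH by blast
    note Vc = unitary_matD[OF V]
    \<comment> \<open>The block sum of the scalar 1 and \<open>V\<close>; \<open>s'\<close>
      accordingly puts the split-off eigenvalue in front of \<open>s\<close>.\<close>
    define V' where "V' = mat (Suc n) (Suc n)
      (\<lambda>(i, j). case (i, j) of (0, 0) \<Rightarrow> 1 | (Suc i, Suc j) \<Rightarrow> V $$ (i, j) | _ \<Rightarrow> 0)"
    define s' where "s' = case_nat (Re e) s"
    have V'c: "V' \<in> carrier_mat (Suc n) (Suc n)" by (simp add: V'_def)
    have V': "unitary_mat (Suc n) V'"
      by (rule unitary_matI_cols[OF V'c])
         (auto simp: V'_def sum.lessThan_Suc_shift unitary_mat_cols[OF V] split: nat.splits
          simp del: sum.lessThan_Suc)
    have "B = diag_conj (Suc n) V' s'"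
    proof (rule eq_matI)
      fix i j assume "i < dim_row (diag_conj (Suc n) V' s')" "j < dim_col (diag_conj (Suc n) V' s')"
      then have ij: "i < Suc n" "j < Suc n" using diag_conj_carrier[OF V'c, of s'] by auto
      have "B $$ (Suc i, Suc j) = (\<Sum>k<n. V $$ (i, k) * of_real (s k) * cnj (V $$ (j, k)))"
        if "i < n" "j < n" for i j
        using arg_cong[OF C, of "\<lambda>X. X $$ (i, j)"] that by (simp add: C_def index_diag_conj[OF Vc(1)])
      then show "B $$ (i, j) = diag_conj (Suc n) V' s' $$ (i, j)"
        unfolding index_diag_conj[OF V'c ij]
        using ij B0 B0' eR
        by (auto simp: sum.lessThan_Suc_shift V'_def s'_def split: nat.splits simp del: sum.lessThan_Suc)
    qed (use B diag_conj_carrier[OF V'c, of s'] in auto)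
    moreover have "A = W * B * mat_adjoint W"
    proof -
      have "W * B * mat_adjoint W = (W * mat_adjoint W) * (A * (W * mat_adjoint W))"
        unfolding B_def using Wc(1) A
        by (simp add: assoc_mult_mat[of _ "Suc n" "Suc n" _ "Suc n" _ "Suc n"] del: assoc_mult_mat)
      then show ?thesis using Wc A by simp
    qed
    ultimately have "A = diag_conj (Suc n) (W * V') s'"
      by (simp add: diag_conj_mult_left[OF Wc(1) V'c])
    then show ?case using unitary_mat_mult[OF W V'] by blast
  qed
  then show ?thesis using that by blast
qed

subsection \<open>Functional calculus and trace norm\<close>

lemma mult_cnj_cmod: "z * cnj z = complex_of_real ((cmod z)\<^sup>2)"
  by (rule complex_norm_square[symmetric])

text \<open>The change of basis \<open>X\<close> intertwines the two diagonal matrices, so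
  \<open>X $$ (i, j)\<close> can be nonzero only where \<open>r j = s i\<close>. There
  \<open>g (r j) = g (s i)\<close>, and \<open>X\<close> intertwines the images as well. Repeated
  eigenvalues need no separate treatment.\<close>

lemma diag_conj_fun_unique:
  assumes U: "unitary_mat n U" and W: "unitary_mat n W"
    and eq: "diag_conj n U r = diag_conj n W s"
  shows "diag_conj n U (\<lambda>i. g (r i)) = diag_conj n W (\<lambda>i. g (s i))"
proof -
  let ?D = "\<lambda>r. mat_diag n (\<lambda>i. complex_of_real (r i))"
  note Uc = unitary_matD[OF U] and Wc = unitary_matD[OF W]
  note assoc = assoc_mult_mat[of _ n n _ n _ n]
  define X where "X = mat_adjoint W * U"
  have X: "X \<in> carrier_mat n n" using Uc Wc by (simp add: X_def)
  have l: "mat_adjoint W * diag_conj n U r * U = X * ?D r" for r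
  proof -
    have "mat_adjoint W * diag_conj n U r * U = X * ?D r * (mat_adjoint U * U)"
      using Uc(1) Wc(1) by (simp add: X_def diag_conj_def assoc del: assoc_mult_mat)
    then show ?thesis using Uc X by simp
  qed
  have w: "mat_adjoint W * diag_conj n W r * U = ?D r * X" for r
  proof -
    have "mat_adjoint W * diag_conj n W r * U = (mat_adjoint W * W) * (?D r * X)"
      using Uc(1) Wc(1) by (simp add: X_def diag_conj_def assoc del: assoc_mult_mat)
    then show ?thesis using Wc X by simp
  qed
  have XD: "X * ?D r = ?D s * X" using l[of r] w[of s] eq by simp
  have e: "X $$ (i, j) * of_real (r j) = of_real (s i) * X $$ (i, j)" if "i < n" "j < n" for i j
    using arg_cong[OF XD[unfolded mat_diag_mult_right[OF X] mat_diag_mult_left[OF X]],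
        of "\<lambda>A. A $$ (i, j)"] that by simp
  have "X $$ (i, j) * of_real (g (r j)) = of_real (g (s i)) * X $$ (i, j)" if "i < n" "j < n" for i j
    using e[OF that] by (cases "X $$ (i, j) = 0") auto
  then have "X * ?D (\<lambda>i. g (r i)) = ?D (\<lambda>i. g (s i)) * X"
    by (simp add: mat_diag_mult_right[OF X] mat_diag_mult_left[OF X])
       (intro cong_mat, auto)
  then have "W * (mat_adjoint W * diag_conj n U (\<lambda>i. g (r i)) * U) * mat_adjoint U
      = W * (mat_adjoint W * diag_conj n W (\<lambda>i. g (s i)) * U) * mat_adjoint U"
    by (simp only: l w)
  moreover have "W * (mat_adjoint W * A * U) * mat_adjoint U = A" if "A \<in> carrier_mat n n" for A
  proof -
    have "W * (mat_adjoint W * A * U) * mat_adjoint U = (W * mat_adjoint W) * (A * (U * mat_adjoint U))"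
      using Uc(1) Wc(1) that by (simp add: assoc del: assoc_mult_mat)
    then show ?thesis using Uc Wc that by simp
  qed
  ultimately show ?thesis using Uc(1) Wc(1) by simp
qed

text \<open>Uniqueness resolves the definite description, so the functional calculus can be
  evaluated in any unitary eigenbasis.\<close>

lemma herm_fun_diag_conj:
  assumes U: "unitary_mat n U"
  shows "herm_fun g (diag_conj n U r) = diag_conj n U (\<lambda>i. g (r i))"
proof -
  have n: "dim_row (diag_conj n U r) = n" using unitary_matD(1)[OF U] by simp
  have "herm_fun g (diag_conj n U r) =
    (THE B. \<exists>W s. unitary_mat n W \<and> diag_conj n U r = diag_conj n W s \<and> B = diag_conj n W (\<lambda>i. g (s i)))"
    unfolding herm_fun_def Let_def n unfolding unitary_mat_def diag_conj_def by (simp only: conj_assoc)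
  also have "\<dots> = diag_conj n U (\<lambda>i. g (r i))"
    using U diag_conj_fun_unique by (intro the_equality) metis+
  finally show ?thesis .
qed

lemma mat_trace_diag_conj:
  assumes U: "unitary_mat n U"
  shows "mat_trace (diag_conj n U r) = of_real (\<Sum>i<n. r i)"
proof -
  note Uc = unitary_matD(1)[OF U]
  have "mat_trace (diag_conj n U r) = (\<Sum>i<n. \<Sum>k<n. of_real (r k) * (cnj (U $$ (i, k)) * U $$ (i, k)))"
    unfolding mat_trace_def using Uc by (simp add: index_diag_conj[OF Uc] mult_ac)
  also have "\<dots> = (\<Sum>k<n. of_real (r k) * (\<Sum>i<n. cnj (U $$ (i, k)) * U $$ (i, k)))"
    by (subst sum.swap) (simp add: sum_distrib_left)
  finally show ?thesis by (simp add: unitary_mat_cols[OF U])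
qed

section \<open>Trace norm and Hilbert-Schmidt norm of Hermitian matrices\<close>

lemma trace_norm_diag_conj:
  assumes U: "unitary_mat n U"
  shows "trace_norm (diag_conj n U r) = (\<Sum>i<n. \<bar>r i\<bar>)"
  using unitary_matD(1)[OF U]
  by (simp add: trace_norm_def mat_adjoint_diag_conj diag_conj_mult[OF U] herm_fun_diag_conj[OF U]
      mat_trace_diag_conj[OF U] flip: of_real_sum)

lemma trace_norm_minus_commute:
  assumes "A \<in> carrier_mat n n" "B \<in> carrier_mat n n"
  shows "trace_norm (A - B) = trace_norm (B - A)"
proof -
  have "mat_adjoint (A - B) * (A - B) = mat_adjoint (B - A) * (B - A)"
    using assms
    by (intro eq_matI)
       (auto simp: index_mult_mat_sum[of _ n n _ n] minus_carrier_mat[of _ n n] algebra_simps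
          simp del: index_mult_mat(1) intro!: sum.cong)
  then show ?thesis by (simp add: trace_norm_def)
qed

text \<open>Each diagonal entry in the new basis is a combination of eigenvalues with weights
  \<open>(cmod (X $$ (i, k)))\<^sup>2\<close>. After the triangle inequality, summing over
  \<open>i\<close> gives every eigenvalue total weight 1, because the columns of the unitary
  \<open>X\<close> are normalized.\<close>

lemma trace_norm_ge_diag:
  assumes A: "A \<in> carrier_mat n n" "mat_adjoint A = A" and W: "unitary_mat n W"
  shows "(\<Sum>i<n. cmod ((mat_adjoint W * A * W) $$ (i, i))) \<le> trace_norm A"
proof -
  obtain U r where U: "unitary_mat n U" and r: "A = diag_conj n U r"
    using hermitian_diagonalizable[OF A] .
  note Uc = unitary_matD[OF U] and Wc = unitary_matD[OF W]
  have "unitary_mat n (mat_adjoint W)" using Wc by (simp add: unitary_mat_def)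
  then have X: "unitary_mat n (mat_adjoint W * U)" using U by (rule unitary_mat_mult)
  define X where "X = mat_adjoint W * U"
  note X = X[folded X_def]
  have "mat_adjoint W * A * W = diag_conj n X r"
    using diag_conj_mult_left[of "mat_adjoint W" n U r] Uc Wc r by (simp add: X_def)
  then have "(\<Sum>i<n. cmod ((mat_adjoint W * A * W) $$ (i, i)))
      = (\<Sum>i<n. cmod (\<Sum>k<n. X $$ (i, k) * of_real (r k) * cnj (X $$ (i, k))))"
    using unitary_matD(1)[OF X] by (simp add: index_diag_conj)
  also have "\<dots> \<le> (\<Sum>i<n. \<Sum>k<n. \<bar>r k\<bar> * (cmod (X $$ (i, k)))\<^sup>2)"
    by (intro sum_mono order.trans[OF norm_sum]) (simp add: norm_mult power2_eq_square)
  also have "\<dots> = (\<Sum>k<n. \<bar>r k\<bar> * (\<Sum>i<n. (cmod (X $$ (i, k)))\<^sup>2))"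
    by (subst sum.swap) (simp add: sum_distrib_left)
  also have "\<dots> = (\<Sum>k<n. \<bar>r k\<bar>)"
  proof (intro sum.cong refl)
    fix k assume "k \<in> {..<n}"
    then have "complex_of_real (\<Sum>i<n. (cmod (X $$ (i, k)))\<^sup>2) = 1"
      using unitary_mat_cols[OF X, of k k] by (simp add: mult_cnj_cmod mult.commute)
    then show "\<bar>r k\<bar> * (\<Sum>i<n. (cmod (X $$ (i, k)))\<^sup>2) = \<bar>r k\<bar>" by (simp only: of_real_eq_1_iff mult_1_right)
  qed
  also have "\<dots> = trace_norm A" by (simp add: r trace_norm_diag_conj[OF U])
  finally show ?thesis .
qed

lemma index_hermitian_square:
  assumes A: "A \<in> carrier_mat n n" "mat_adjoint A = A" and i: "i < n"
  shows "(A * A) $$ (i, i) = of_real (\<Sum>j<n. (cmod (A $$ (i, j)))\<^sup>2)"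
proof -
  have "A $$ (j, i) = cnj (A $$ (i, j))" if "j < n" for j
    using arg_cong[OF A(2), of "\<lambda>X. X $$ (j, i)"] A(1) i that by simp
  then show ?thesis
    using A i by (simp add: index_mult_mat_sum[of _ n n _ n] mult_cnj_cmod del: index_mult_mat(1))
qed

text \<open>For Hermitian \<open>A\<close> the squared Hilbert-Schmidt norm is the trace of
  \<open>A * A\<close>, which the spectral form shows to be the sum of the squared
  eigenvalues.\<close>

lemma frobenius_diag_conj:
  assumes U: "unitary_mat n U"
  shows "(\<Sum>i<n. \<Sum>j<n. (cmod (diag_conj n U r $$ (i, j)))\<^sup>2) = (\<Sum>i<n. (r i)\<^sup>2)"
proof -
  note Uc = unitary_matD(1)[OF U]
  let ?A = "diag_conj n U r"
  have "complex_of_real (\<Sum>i<n. \<Sum>j<n. (cmod (?A $$ (i, j)))\<^sup>2) = mat_trace (?A * ?A)"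
    unfolding mat_trace_def
    using index_hermitian_square[OF diag_conj_carrier[OF Uc] mat_adjoint_diag_conj[OF Uc]] Uc by simp
  also have "\<dots> = of_real (\<Sum>i<n. (r i)\<^sup>2)"
    by (simp only: diag_conj_mult[OF U] mat_trace_diag_conj[OF U] power2_eq_square)
  finally show ?thesis by (simp only: of_real_eq_iff)
qed

lemma mat_adjoint_minus:
  fixes A :: "complex mat"
  assumes "A \<in> carrier_mat n m" "B \<in> carrier_mat n m"
  shows "mat_adjoint (A - B) = mat_adjoint A - mat_adjoint B"
  using assms by (intro eq_matI) auto

lemma diag_conj_diag_nonneg:
  assumes "U \<in> carrier_mat n n" "\<And>k. k < n \<Longrightarrow> 0 \<le> r k" "i < n"
  obtains x where "0 \<le> x" "diag_conj n U r $$ (i, i) = of_real x"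
proof
  have "U $$ (i, k) * of_real (r k) * cnj (U $$ (i, k)) = of_real (r k * (cmod (U $$ (i, k)))\<^sup>2)" for k
    by (simp only: of_real_mult complex_norm_square mult_ac)
  then show "diag_conj n U r $$ (i, i) = of_real (\<Sum>k<n. r k * (cmod (U $$ (i, k)))\<^sup>2)"
    using assms by (simp only: index_diag_conj of_real_sum)
  show "0 \<le> (\<Sum>k<n. r k * (cmod (U $$ (i, k)))\<^sup>2)" using assms by (auto intro!: sum_nonneg)
qed

text \<open>
  In an eigenbasis of \<open>R - S\<close> the matrices \<open>R\<close> and \<open>S\<close> differ only on the diagonal, so the \<open>i\<close>-th
  diagonal entry of \<open>R\<^sup>2 - S\<^sup>2\<close> is \<open>R\<^sub>i\<^sub>i\<^sup>2 - S\<^sub>i\<^sub>i\<^sup>2\<close>, which dominates \<open>(R\<^sub>i\<^sub>i - S\<^sub>i\<^sub>i)\<^sup>2\<close>.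
\<close>

lemma powers_stormer:
  assumes U: "unitary_mat n U" and V: "unitary_mat n V"
    and r: "\<And>i. i < n \<Longrightarrow> 0 \<le> r i" and s: "\<And>i. i < n \<Longrightarrow> 0 \<le> s i"
  defines "R \<equiv> diag_conj n U r" and "S \<equiv> diag_conj n V s"
  shows "(\<Sum>i<n. \<Sum>j<n. (cmod (R $$ (i, j) - S $$ (i, j)))\<^sup>2) \<le> trace_norm (R * R - S * S)"
proof -
  note Uc = unitary_matD[OF U] and Vc = unitary_matD[OF V]
  note assoc = assoc_mult_mat[of _ n n _ n _ n]
  have R: "R \<in> carrier_mat n n" "mat_adjoint R = R" and S: "S \<in> carrier_mat n n" "mat_adjoint S = S"
    using Uc(1) Vc(1) by (simp_all add: R_def S_def mat_adjoint_diag_conj)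
  have D: "R - S \<in> carrier_mat n n" "mat_adjoint (R - S) = R - S"
    using R S by (simp_all add: mat_adjoint_minus[of _ n n] minus_carrier_mat[of _ n n])
  obtain Z l where Z: "unitary_mat n Z" and l: "R - S = diag_conj n Z l"
    using hermitian_diagonalizable[OF D] .
  note Zc = unitary_matD[OF Z]
  let ?c = "\<lambda>A. mat_adjoint Z * A * Z"
  define R' where "R' = ?c R"
  define S' where "S' = ?c S"
  have R': "R' = diag_conj n (mat_adjoint Z * U) r" and S': "S' = diag_conj n (mat_adjoint Z * V) s"
    using diag_conj_mult_left[of "mat_adjoint Z" n U r] diag_conj_mult_left[of "mat_adjoint Z" n V s]
      Zc Uc Vc by (simp_all add: R'_def S'_def R_def S_def)
  have cU: "mat_adjoint Z * U \<in> carrier_mat n n" and cV: "mat_adjoint Z * V \<in> carrier_mat n n"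
    using Zc Uc Vc by simp_all
  have R'c: "R' \<in> carrier_mat n n" "mat_adjoint R' = R'" and S'c: "S' \<in> carrier_mat n n" "mat_adjoint S' = S'"
    using cU cV by (simp_all add: R' S' mat_adjoint_diag_conj)
  have cminus: "?c (A - B) = ?c A - ?c B" if "A \<in> carrier_mat n n" "B \<in> carrier_mat n n" for A B
    using that Zc by (simp add: mult_minus_distrib_mat[of _ n n _ n] minus_mult_distrib_mat[of _ n n])
  have csq: "?c (A * A) = ?c A * ?c A" if "A \<in> carrier_mat n n" for A
  proof -
    have "?c A * ?c A = mat_adjoint Z * (A * ((Z * mat_adjoint Z) * (A * Z)))"
      using Zc(1) that by (simp add: assoc del: assoc_mult_mat)
    then show ?thesis using Zc that by (simp add: assoc del: assoc_mult_mat)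
  qed
  have RS: "R' - S' = mat_diag n (\<lambda>i. complex_of_real (l i))"
    using cminus[OF R(1) S(1)] conj_diag_conj[OF Z] by (simp add: R'_def S'_def l)
  have off: "R' $$ (i, j) = S' $$ (i, j) + (if i = j then of_real (l i) else 0)" if "i < n" "j < n" for i j
    using arg_cong[OF RS, of "\<lambda>X. X $$ (i, j)"] that R'c(1) S'c(1)
    by (auto simp: mat_diag_def algebra_simps)
  have "(l i)\<^sup>2 \<le> cmod ((R' * R' - S' * S') $$ (i, i))" if i: "i < n" for i
  proof -
    obtain x y where x: "0 \<le> x" "R' $$ (i, i) = of_real x" and y: "0 \<le> y" "S' $$ (i, i) = of_real y"
      using diag_conj_diag_nonneg[of "mat_adjoint Z * U" n r i, folded R', OF cU r i]
        diag_conj_diag_nonneg[of "mat_adjoint Z * V" n s i, folded S', OF cV s i] by metis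
    have lxy: "x = y + l i" using off[OF i i] x y by (simp flip: of_real_add)
    have sum: "(\<Sum>j<n. (cmod (A $$ (i, j)))\<^sup>2)
      = (cmod (A $$ (i, i)))\<^sup>2 + (\<Sum>j\<in>{..<n} - {i}. (cmod (A $$ (i, j)))\<^sup>2)" for A
      using i by (intro sum.remove) auto
    have off': "(\<Sum>j\<in>{..<n} - {i}. (cmod (R' $$ (i, j)))\<^sup>2) = (\<Sum>j\<in>{..<n} - {i}. (cmod (S' $$ (i, j)))\<^sup>2)"
      using off[OF i] by (intro sum.cong) auto
    have "(R' * R' - S' * S') $$ (i, i) = (R' * R') $$ (i, i) - (S' * S') $$ (i, i)"
      using R'c S'c i by simp
    also have "\<dots> = of_real ((\<Sum>j<n. (cmod (R' $$ (i, j)))\<^sup>2) - (\<Sum>j<n. (cmod (S' $$ (i, j)))\<^sup>2))"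
      by (simp only: index_hermitian_square[OF R'c i] index_hermitian_square[OF S'c i] of_real_diff)
    also have "\<dots> = of_real (x\<^sup>2 - y\<^sup>2)"
      unfolding sum[of R'] sum[of S'] off' x(2) y(2) by simp
    finally have "cmod ((R' * R' - S' * S') $$ (i, i)) = \<bar>x\<^sup>2 - y\<^sup>2\<bar>" by (simp only: norm_of_real)
    also have "x\<^sup>2 - y\<^sup>2 = l i * (x + y)"
      unfolding lxy by (simp add: power2_eq_square algebra_simps)
    also have "\<bar>l i * (x + y)\<bar> = \<bar>l i\<bar> * (x + y)"
      using x(1) y(1) by (simp add: abs_mult)
    \<comment> \<open>Here \<open>l i = x - y\<close> with \<open>x\<close> and \<open>y\<close>
      nonnegative, so its modulus is at most \<open>x + y\<close>. This is where positivity of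
      \<open>R\<close> and \<open>S\<close> enters.\<close>
    also have "\<dots> \<ge> \<bar>l i\<bar> * \<bar>l i\<bar>"
      using x y lxy by (intro mult_left_mono) auto
    finally show ?thesis by (simp add: power2_eq_square)
  qed
  then have "(\<Sum>i<n. (l i)\<^sup>2) \<le> (\<Sum>i<n. cmod (?c (R * R - S * S) $$ (i, i)))"
    using R S by (intro sum_mono) (simp add: cminus csq R'_def S'_def)
  also have "\<dots> \<le> trace_norm (R * R - S * S)"
    using R S by (intro trace_norm_ge_diag Z)
      (simp_all add: mat_adjoint_minus[of _ n n] minus_carrier_mat[of _ n n] mat_adjoint_mult[of _ n n _ n])
  finally show ?thesis
    using frobenius_diag_conj[OF Z, of l] R(1) S(1) by (simp flip: l)
qed

section \<open>Parseval identities for orthonormal families\<close>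

lemma orthonormal_inner:
  fixes V :: "nat \<Rightarrow> 'k \<Rightarrow> complex"
  assumes "\<And>i j. i < n \<Longrightarrow> j < n \<Longrightarrow> (\<Sum>k\<in>K. V i k * cnj (V j k)) = (if i = j then 1 else 0)"
  shows "(\<Sum>k\<in>K. (\<Sum>i<n. x i * V i k) * cnj (\<Sum>j<n. y j * V j k)) = (\<Sum>i<n. x i * cnj (y i))"
proof -
  have "(\<Sum>k\<in>K. (\<Sum>i<n. x i * V i k) * cnj (\<Sum>j<n. y j * V j k))
      = (\<Sum>k\<in>K. \<Sum>i<n. \<Sum>j<n. x i * cnj (y j) * (V i k * cnj (V j k)))"
    by (simp add: sum_product mult_ac)
  also have "\<dots> = (\<Sum>i<n. \<Sum>j<n. \<Sum>k\<in>K. x i * cnj (y j) * (V i k * cnj (V j k)))"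
    by (subst sum.swap) (intro sum.cong refl sum.swap)
  also have "\<dots> = (\<Sum>i<n. \<Sum>j<n. x i * cnj (y j) * (if i = j then 1 else 0))"
    by (intro sum.cong refl) (simp only: sum_distrib_left[symmetric] assms lessThan_iff)
  finally show ?thesis by (simp add: if_distrib[of "times _"] cong: if_cong)
qed

lemma orthonormal_norm:
  fixes V :: "nat \<Rightarrow> 'k \<Rightarrow> complex"
  assumes "\<And>i j. i < n \<Longrightarrow> j < n \<Longrightarrow> (\<Sum>k\<in>K. V i k * cnj (V j k)) = (if i = j then 1 else 0)"
  shows "(\<Sum>k\<in>K. (cmod (\<Sum>i<n. x i * V i k))\<^sup>2) = (\<Sum>i<n. (cmod (x i))\<^sup>2)"
proof -
  have "complex_of_real (\<Sum>k\<in>K. (cmod (\<Sum>i<n. x i * V i k))\<^sup>2) = of_real (\<Sum>i<n. (cmod (x i))\<^sup>2)"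
    using orthonormal_inner[OF assms, where x = x and y = x] by (simp only: of_real_sum complex_norm_square)
  then show ?thesis by (simp only: of_real_eq_iff)
qed

subsection \<open>Gram matrices\<close>

text \<open>The product of \<open>M\<close> with its adjoint. The columns are indexed by an
  arbitrary set instead of an initial segment of the naturals, so that a traced-out index can be
  moved into the column index.\<close>

definition gram :: "nat \<Rightarrow> 'k set \<Rightarrow> (nat \<Rightarrow> 'k \<Rightarrow> complex) \<Rightarrow> complex mat" where
  "gram n K M = mat n n (\<lambda>(i, j). \<Sum>k\<in>K. M i k * cnj (M j k))"

lemma gram_carrier [simp]: "gram n K M \<in> carrier_mat n n"
  and gram_dim [simp]: "dim_row (gram n K M) = n" "dim_col (gram n K M) = n"
  and index_gram: "i < n \<Longrightarrow> j < n \<Longrightarrow> gram n K M $$ (i, j) = (\<Sum>k\<in>K. M i k * cnj (M j k))"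
  by (simp_all add: gram_def)

lemma mat_adjoint_gram [simp]: "mat_adjoint (gram n K M) = gram n K M"
  by (rule eq_matI) (auto simp: index_gram mult.commute)

lemma gram_conj:
  assumes "X \<in> carrier_mat n n"
  shows "X * gram n K M * mat_adjoint X = gram n K (\<lambda>i k. \<Sum>a<n. X $$ (i, a) * M a k)" (is "?L = ?R")
proof (rule eq_matI)
  fix i j assume "i < dim_row ?R" "j < dim_col ?R"
  then have ij: "i < n" "j < n" by auto
  have "?L $$ (i, j) = (\<Sum>b<n. (\<Sum>a<n. X $$ (i, a) * (\<Sum>k\<in>K. M a k * cnj (M b k))) * cnj (X $$ (j, b)))"
    using assms ij by (simp add: index_mult_mat_sum[of _ n n _ n] index_gram del: index_mult_mat(1))
  also have "\<dots> = (\<Sum>b<n. \<Sum>a<n. \<Sum>k\<in>K. (X $$ (i, a) * M a k) * cnj (X $$ (j, b) * M b k))"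
    by (simp add: sum_distrib_left sum_distrib_right mult_ac)
  also have "\<dots> = (\<Sum>b<n. \<Sum>k\<in>K. \<Sum>a<n. (X $$ (i, a) * M a k) * cnj (X $$ (j, b) * M b k))"
    by (intro sum.cong refl sum.swap)
  also have "\<dots> = (\<Sum>k\<in>K. \<Sum>b<n. \<Sum>a<n. (X $$ (i, a) * M a k) * cnj (X $$ (j, b) * M b k))"
    by (rule sum.swap)
  also have "\<dots> = (\<Sum>k\<in>K. \<Sum>a<n. \<Sum>b<n. (X $$ (i, a) * M a k) * cnj (X $$ (j, b) * M b k))"
    by (intro sum.cong refl sum.swap)
  also have "\<dots> = ?R $$ (i, j)"
    using ij by (simp add: index_gram sum_product)
  finally show "?L $$ (i, j) = ?R $$ (i, j)" .
qed (use assms in auto)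

text \<open>The difference of squares is at most \<open>d * (p + q)\<close>, which is split by the
  weighted arithmetic-geometric mean inequality. The free parameter \<open>t\<close> later replaces
  an application of Cauchy-Schwarz.\<close>

lemma abs_diff_cmod_square_le:
  fixes a b :: complex
  assumes "t > 0"
  shows "\<bar>(cmod a)\<^sup>2 - (cmod b)\<^sup>2\<bar> \<le> (cmod (a - b))\<^sup>2 / (2 * t) + t * ((cmod a)\<^sup>2 + (cmod b)\<^sup>2)"
proof -
  define p q d where "p = cmod a" and "q = cmod b" and "d = cmod (a - b)"
  have nn: "p \<ge> 0" "q \<ge> 0" and d: "\<bar>p - q\<bar> \<le> d"
    by (auto simp: p_def q_def d_def norm_triangle_ineq3)
  have "p\<^sup>2 - q\<^sup>2 = (p - q) * (p + q)" by (simp add: power2_eq_square algebra_simps)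
  then have "\<bar>p\<^sup>2 - q\<^sup>2\<bar> = \<bar>p - q\<bar> * (p + q)" using nn by (simp add: abs_mult)
  also have "\<dots> \<le> d * (p + q)" using d nn by (intro mult_right_mono) auto
  finally have *: "\<bar>p\<^sup>2 - q\<^sup>2\<bar> \<le> d * (p + q)" .
  \<comment> \<open>The second square complements \<open>(p + q)\<^sup>2\<close> to
    \<open>2 * (p\<^sup>2 + q\<^sup>2)\<close>.\<close>
  have "0 \<le> (d - t * (p + q))\<^sup>2 + t\<^sup>2 * (p - q)\<^sup>2" by simp
  then have "2 * t * (d * (p + q)) \<le> d\<^sup>2 + 2 * t * (t * (p\<^sup>2 + q\<^sup>2))"
    by (simp add: power2_eq_square algebra_simps)
  then have "d * (p + q) \<le> (d\<^sup>2 + 2 * t * (t * (p\<^sup>2 + q\<^sup>2))) / (2 * t)"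
    using assms by (simp add: field_simps)
  also have "\<dots> = d\<^sup>2 / (2 * t) + t * (p\<^sup>2 + q\<^sup>2)"
    using assms by (simp add: field_simps)
  finally show ?thesis using * by (simp add: p_def q_def d_def)
qed

text \<open>In an eigenbasis of the difference, each eigenvalue is a difference of squared row norms
  of the rotated factors, to which the scalar estimate applies entrywise. The rotation preserves the
  Hilbert-Schmidt sums. Neither \<open>n\<close> nor \<open>K\<close> enters the constants, which
  makes the later estimates independent of the dimension of E.\<close>

lemma trace_norm_gram_diff:
  assumes t: "t > 0"
  shows "trace_norm (gram n K M - gram n K L)
    \<le> (\<Sum>i<n. \<Sum>k\<in>K. (cmod (M i k - L i k))\<^sup>2) / (2 * t)
      + t * ((\<Sum>i<n. \<Sum>k\<in>K. (cmod (M i k))\<^sup>2) + (\<Sum>i<n. \<Sum>k\<in>K. (cmod (L i k))\<^sup>2))"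
proof -
  let ?D = "gram n K M - gram n K L"
  have "?D \<in> carrier_mat n n" "mat_adjoint ?D = ?D"
    by (simp_all add: minus_carrier_mat[of _ n n] mat_adjoint_minus[of _ n n])
  then obtain U r where U: "unitary_mat n U" and r: "?D = diag_conj n U r"
    using hermitian_diagonalizable by blast
  note Uc = unitary_matD[OF U]
  define Y where "Y = mat_adjoint U"
  have Y: "Y \<in> carrier_mat n n" using Uc by (simp add: Y_def)
  define tr where "tr N = (\<lambda>i k. \<Sum>a<n. Y $$ (i, a) * N a k)" for N :: "nat \<Rightarrow> 'a \<Rightarrow> complex"
  have parseval: "(\<Sum>i<n. \<Sum>k\<in>K. (cmod (tr N i k))\<^sup>2) = (\<Sum>i<n. \<Sum>k\<in>K. (cmod (N i k))\<^sup>2)" for N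
  proof -
    \<comment> \<open>The columns of \<open>Y\<close> are orthonormal, so Parseval is applied in the
      row index, separately for each column \<open>k\<close> of the factor.\<close>
    have "(\<Sum>i<n. Y $$ (i, a) * cnj (Y $$ (i, b))) = (if a = b then 1 else 0)" if "a < n" "b < n" for a b
      using unitary_mat_rows[OF U that(2,1)] Uc that by (auto simp: Y_def mult.commute)
    note on = orthonormal_norm[of n "\<lambda>a i. Y $$ (i, a)" "{..<n}", OF this]
    have "(\<Sum>i<n. (cmod (tr N i k))\<^sup>2) = (\<Sum>i<n. (cmod (N i k))\<^sup>2)" for k
      using on[of "\<lambda>a. N a k"] by (simp add: tr_def mult.commute)
    then show ?thesis by (subst (1 2) sum.swap) simp
  qed
  have "\<bar>r i\<bar> \<le> (\<Sum>k\<in>K. (cmod (tr M i k - tr L i k))\<^sup>2 / (2 * t)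
      + t * ((cmod (tr M i k))\<^sup>2 + (cmod (tr L i k))\<^sup>2))" if i: "i < n" for i
  proof -
    have "mat_diag n (\<lambda>i. complex_of_real (r i)) = Y * ?D * mat_adjoint Y"
      using conj_diag_conj[OF U, of r] by (simp add: Y_def r)
    also have "\<dots> = gram n K (tr M) - gram n K (tr L)"
      using Y by (simp add: mult_minus_distrib_mat[of _ n n _ n] minus_mult_distrib_mat[of _ n n _ _ n]
          gram_conj[OF Y] tr_def)
    finally have "mat_diag n (\<lambda>i. complex_of_real (r i)) $$ (i, i)
        = (gram n K (tr M) - gram n K (tr L)) $$ (i, i)" by (rule arg_cong)
    then have "complex_of_real (r i) = of_real (\<Sum>k\<in>K. (cmod (tr M i k))\<^sup>2 - (cmod (tr L i k))\<^sup>2)"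
      using i by (simp add: mat_diag_def index_gram mult_cnj_cmod sum_subtractf)
    then have "r i = (\<Sum>k\<in>K. (cmod (tr M i k))\<^sup>2 - (cmod (tr L i k))\<^sup>2)"
      by (simp only: of_real_eq_iff)
    then have "\<bar>r i\<bar> \<le> (\<Sum>k\<in>K. \<bar>(cmod (tr M i k))\<^sup>2 - (cmod (tr L i k))\<^sup>2\<bar>)"
      by (simp only: sum_abs)
    also have "\<dots> \<le> (\<Sum>k\<in>K. (cmod (tr M i k - tr L i k))\<^sup>2 / (2 * t)
      + t * ((cmod (tr M i k))\<^sup>2 + (cmod (tr L i k))\<^sup>2))"
      by (intro sum_mono abs_diff_cmod_square_le t)
    finally show ?thesis .
  qed
  then have le: "(\<Sum>i<n. \<bar>r i\<bar>) \<le> (\<Sum>i<n. \<Sum>k\<in>K. (cmod (tr M i k - tr L i k))\<^sup>2 / (2 * t)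
      + t * ((cmod (tr M i k))\<^sup>2 + (cmod (tr L i k))\<^sup>2))"
    by (intro sum_mono) simp
  have tr_diff: "tr M i k - tr L i k = tr (\<lambda>i k. M i k - L i k) i k" for i k
    by (simp add: tr_def sum_subtractf algebra_simps)
  from le[unfolded tr_diff] have "(\<Sum>i<n. \<bar>r i\<bar>) \<le> (\<Sum>i<n. \<Sum>k\<in>K. (cmod (tr (\<lambda>i k. M i k - L i k) i k))\<^sup>2) / (2 * t)
      + t * ((\<Sum>i<n. \<Sum>k\<in>K. (cmod (tr M i k))\<^sup>2) + (\<Sum>i<n. \<Sum>k\<in>K. (cmod (tr L i k))\<^sup>2))"
    by (simp add: sum.distrib sum_divide_distrib sum_distrib_left distrib_left)
  then show ?thesis by (simp only: parseval r trace_norm_diag_conj[OF U])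
qed

section \<open>Gram factors of density operators\<close>

lemma mat_trace_gram: "mat_trace (gram n K M) = of_real (\<Sum>i<n. \<Sum>k\<in>K. (cmod (M i k))\<^sup>2)"
  by (simp add: mat_trace_def index_gram mult_cnj_cmod)

text \<open>The quadratic form at \<open>v\<close> is the squared norm of the adjoint of
  \<open>M\<close> applied to \<open>v\<close>, and the trace is the Hilbert-Schmidt sum in the
  hypothesis.\<close>

lemma density_gram:
  assumes "(\<Sum>i<n. \<Sum>k\<in>K. (cmod (M i k))\<^sup>2) = 1"
  shows "density_operator n (gram n K M)"
  unfolding density_operator_def
proof (intro conjI ballI)
  fix v :: "complex vec" assume v: "v \<in> carrier_vec n"
  have "(gram n K M *\<^sub>v v) \<bullet>c v = (\<Sum>i<n. (\<Sum>j<n. (\<Sum>k\<in>K. M i k * cnj (M j k)) * v $ j) * cnj (v $ i))"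
    using v by (simp add: scalar_prod_def atLeast0LessThan index_gram)
  also have "\<dots> = (\<Sum>i<n. \<Sum>j<n. \<Sum>k\<in>K. (cnj (v $ i) * M i k) * cnj (cnj (v $ j) * M j k))"
    by (simp add: sum_distrib_left sum_distrib_right mult_ac)
  also have "\<dots> = (\<Sum>i<n. \<Sum>k\<in>K. \<Sum>j<n. (cnj (v $ i) * M i k) * cnj (cnj (v $ j) * M j k))"
    by (intro sum.cong refl sum.swap)
  also have "\<dots> = (\<Sum>k\<in>K. (\<Sum>i<n. cnj (v $ i) * M i k) * cnj (\<Sum>j<n. cnj (v $ j) * M j k))"
    by (subst sum.swap) (simp add: sum_product)
  also have "\<dots> = of_real (\<Sum>k\<in>K. (cmod (\<Sum>i<n. cnj (v $ i) * M i k))\<^sup>2)"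
    by (simp only: mult_cnj_cmod of_real_sum)
  finally show "0 \<le> (gram n K M *\<^sub>v v) \<bullet>c v"
    by (simp add: less_eq_complex_def sum_nonneg del: of_real_power of_real_sum)
qed (use assms in \<open>simp_all add: mat_trace_gram del: of_real_sum\<close>)

lemma density_frobenius:
  assumes "density_operator n (gram n K M)"
  shows "(\<Sum>i<n. \<Sum>k\<in>K. (cmod (M i k))\<^sup>2) = 1"
  using assms unfolding density_operator_def mat_trace_gram of_real_eq_1_iff by simp

text \<open>The eigenvalue \<open>r j\<close> is the quadratic form at the \<open>j\<close>-th
  column of \<open>U\<close>.\<close>

lemma density_diagonalizable:
  assumes "density_operator n \<rho>"
  obtains U r where "unitary_mat n U" "\<rho> = diag_conj n U r" "\<And>i. i < n \<Longrightarrow> 0 \<le> r i"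
proof -
  have \<rho>: "\<rho> \<in> carrier_mat n n" "mat_adjoint \<rho> = \<rho>"
    and pos: "\<And>v. v \<in> carrier_vec n \<Longrightarrow> 0 \<le> (\<rho> *\<^sub>v v) \<bullet>c v"
    using assms by (auto simp: density_operator_def)
  obtain U r where U: "unitary_mat n U" and r: "\<rho> = diag_conj n U r"
    using hermitian_diagonalizable[OF \<rho>] .
  note Uc = unitary_matD[OF U]
  show ?thesis
  proof (rule that[OF U r])
    fix j assume j: "j < n"
    have "complex_of_real (r j) = (mat_adjoint U * \<rho> * U) $$ (j, j)"
      using j by (simp only: r conj_diag_conj[OF U]) (simp add: mat_diag_def)
    also have "mat_adjoint U * \<rho> * U = mat_adjoint U * (\<rho> * U)"
      using Uc \<rho> by (simp add: assoc_mult_mat[of _ n n _ n _ n] del: assoc_mult_mat)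
    also have "\<dots> $$ (j, j) = (\<Sum>i<n. cnj (U $$ (i, j)) * (\<Sum>k<n. \<rho> $$ (i, k) * U $$ (k, j)))"
      using Uc \<rho> j by (simp add: index_mult_mat_sum[of _ n n _ n] del: index_mult_mat(1))
    also have "\<dots> = (\<rho> *\<^sub>v col U j) \<bullet>c col U j"
      using Uc \<rho> j by (simp add: scalar_prod_def atLeast0LessThan mult.commute)
    finally have "0 \<le> complex_of_real (r j)" using pos[of "col U j"] Uc j by auto
    then show "0 \<le> r j" by (simp add: less_eq_complex_def)
  qed
qed

lemma diag_conj_eq_gram:
  assumes "U \<in> carrier_mat n n" "\<And>i. i < n \<Longrightarrow> 0 \<le> r i"
  shows "diag_conj n U r = gram n {..<n} (\<lambda>i k. U $$ (i, k) * of_real (sqrt (r k)))" (is "?L = ?R")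
proof (rule eq_matI)
  fix i j assume "i < dim_row ?R" "j < dim_col ?R"
  then show "?L $$ (i, j) = ?R $$ (i, j)"
    using assms by (auto simp: index_diag_conj index_gram mult_ac simp flip: of_real_mult
        intro!: sum.cong)
qed (use assms in auto)

subsection \<open>Partial traces\<close>

lemma mult_add_less:
  fixes i j p q :: nat
  assumes "i < p" "j < q"
  shows "i * q + j < p * q"
proof -
  have "i * q + j < Suc i * q" using assms(2) by simp
  also have "\<dots> \<le> p * q" using assms(1) by (intro mult_le_mono1) simp
  finally show ?thesis .
qed

lemma sum_lessThan_mult:
  fixes h :: "nat \<Rightarrow> 'a :: comm_monoid_add"
  shows "(\<Sum>x<p * q. h x) = (\<Sum>i<p. \<Sum>j<q. h (i * q + j))"
proof -
  have "sum h {i * q..<i * q + q} = (\<Sum>j<q. h (i * q + j))" for i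
    using sum.shift_bounds_nat_ivl[of h 0 "i * q" q] by (simp add: add.commute atLeast0LessThan)
  then show ?thesis by (simp flip: sum.nat_group)
qed

lemma partial_trace_index_less:
  fixes x l n k m :: nat
  assumes "x < n * m" "l < k"
  shows "(x div m * k + l) * m + x mod m < n * k * m"
proof (rule mult_add_less[OF mult_add_less])
  show "x div m < n" using assms by (simp add: less_mult_imp_div_less)
  show "x mod m < m" using assms by (cases "m = 0") auto
qed fact

text \<open>The index \<open>l\<close> of the traced factor is moved from the row index to the
  column index; the entries themselves are unchanged.\<close>

definition partial_trace_factor ::
    "nat \<Rightarrow> nat \<Rightarrow> (nat \<Rightarrow> 'k \<Rightarrow> complex) \<Rightarrow> nat \<Rightarrow> nat \<times> 'k \<Rightarrow> complex" where
  "partial_trace_factor k m M = (\<lambda>x (l, \<kappa>). M ((x div m * k + l) * m + x mod m) \<kappa>)"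

text \<open>A partial trace sums over the traced index exactly as a Gram matrix sums over its
  columns.\<close>

lemma partial_trace_gram:
  "partial_trace n k m (gram (n * k * m) K M) = gram (n * m) ({..<k} \<times> K) (partial_trace_factor k m M)"
  by (rule eq_matI)
     (auto simp: partial_trace_def index_gram partial_trace_index_less partial_trace_factor_def
        case_prod_beta sum.cartesian_product)

lemma sum_partial_trace_index:
  fixes g :: "nat \<Rightarrow> 'a :: comm_monoid_add"
  shows "(\<Sum>x<n * m. \<Sum>l<k. g ((x div m * k + l) * m + x mod m)) = (\<Sum>y<n * k * m. g y)"
proof -
  have "(\<Sum>x<n * m. \<Sum>l<k. g ((x div m * k + l) * m + x mod m))
     = (\<Sum>a<n. \<Sum>c<m. \<Sum>l<k. g ((a * k + l) * m + c))"
    by (simp add: sum_lessThan_mult)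
  also have "\<dots> = (\<Sum>a<n. \<Sum>l<k. \<Sum>c<m. g ((a * k + l) * m + c))"
    by (intro sum.cong refl sum.swap)
  finally show ?thesis by (simp add: sum_lessThan_mult)
qed

text \<open>Regrouping only permutes the entries. The arbitrary \<open>g\<close> covers squared
  norms as well as squared distances.\<close>

lemma frobenius_partial_trace_factor:
  fixes g :: "complex \<Rightarrow> complex \<Rightarrow> real"
  shows "(\<Sum>x<n * m. \<Sum>\<kappa>\<in>{..<k} \<times> K. g (partial_trace_factor k m M x \<kappa>) (partial_trace_factor k m L x \<kappa>))
    = (\<Sum>y<n * k * m. \<Sum>\<kappa>\<in>K. g (M y \<kappa>) (L y \<kappa>))"
  unfolding sum_partial_trace_index[where n = n and m = m and k = k, symmetric]
  by (intro sum.cong refl) (simp add: partial_trace_factor_def case_prod_beta sum.cartesian_product)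

lemma density_partial_trace_gram:
  assumes "density_operator (n * k * m) (gram (n * k * m) K M)"
  shows "density_operator (n * m) (partial_trace n k m (gram (n * k * m) K M))"
  using density_frobenius[OF assms]
    frobenius_partial_trace_factor[where g = "\<lambda>x y. (cmod x)\<^sup>2" and n = n and m = m and k = k and M = M and L = M and K = K]
  by (simp add: partial_trace_gram density_gram)

text \<open>The regrouped factors have the same norms and distance as the original ones, so the
  marginals obey the same bound as the full states, without appeal to monotonicity of the trace norm
  under partial traces.\<close>

lemma trace_norm_partial_trace_gram_diff:
  assumes "t > 0"
  shows "trace_norm (partial_trace n k m (gram (n * k * m) K M) - partial_trace n k m (gram (n * k * m) K L))
    \<le> (\<Sum>i<n * k * m. \<Sum>\<kappa>\<in>K. (cmod (M i \<kappa> - L i \<kappa>))\<^sup>2) / (2 * t)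
      + t * ((\<Sum>i<n * k * m. \<Sum>\<kappa>\<in>K. (cmod (M i \<kappa>))\<^sup>2) + (\<Sum>i<n * k * m. \<Sum>\<kappa>\<in>K. (cmod (L i \<kappa>))\<^sup>2))"
proof -
  note F = frobenius_partial_trace_factor[where n = n and m = m and k = k and K = K]
  show ?thesis
    using trace_norm_gram_diff[OF assms, of "n * m" "{..<k} \<times> K" "partial_trace_factor k m M" "partial_trace_factor k m L"]
    by (simp only: partial_trace_gram F[of "\<lambda>x y. (cmod (x - y))\<^sup>2"] F[of "\<lambda>x y. (cmod x)\<^sup>2" _ M]
        F[of "\<lambda>x y. (cmod x)\<^sup>2" _ L])
qed

lemma partial_trace_twice:
  assumes "\<rho> \<in> carrier_mat (dA * dB * dE) (dA * dB * dE)"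
  shows "partial_trace 1 dA dE (partial_trace dA dB dE \<rho>) = partial_trace 1 (dA * dB) dE \<rho>"
proof (rule eq_matI)
  fix i j assume "i < dim_row (partial_trace 1 (dA * dB) dE \<rho>)" "j < dim_col (partial_trace 1 (dA * dB) dE \<rho>)"
  then have ij: "i < dE" "j < dE" by (auto simp: partial_trace_def)
  then have "l * dE + i < dA * dE" "l * dE + j < dA * dE" if "l < dA" for l
    using that mult_add_less by auto
  then show "partial_trace 1 dA dE (partial_trace dA dB dE \<rho>) $$ (i, j) = partial_trace 1 (dA * dB) dE \<rho> $$ (i, j)"
    using ij by (simp add: partial_trace_def sum_lessThan_mult)
qed (auto simp: partial_trace_def)

text \<open>Both conditional entropies have A as their first system, so the continuity bound for
  them involves \<open>dA\<close> only, whatever the dimension of E.\<close>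

lemma cond_mutual_info_eq:
  assumes "\<rho> \<in> carrier_mat (dA * dB * dE) (dA * dB * dE)"
  shows "cond_mutual_info dA dB dE \<rho>
    = cond_entropy dA dE (partial_trace dA dB dE \<rho>) - cond_entropy dA (dB * dE) \<rho>"
  by (simp only: cond_mutual_info_def cond_entropy_def partial_trace_twice[OF assms])

subsection \<open>Nearby extensions\<close>

text \<open>
  Uhlmann: \<open>\<Psi>\<close> is \<open>\<rho>\<^sup>1\<^sup>/\<^sup>2 V\<close> for a partial isometry \<open>V\<close>, which the unused columns \<open>p j\<close> allow to extend
  to a coisometry; then \<open>\<Phi> = \<sigma>\<^sup>1\<^sup>/\<^sup>2 V\<close> has the distance of the square roots from \<open>\<Psi>\<close>.
\<close>

lemma gram_perturbation:
  fixes \<Psi> :: "nat \<Rightarrow> 'k \<Rightarrow> complex"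
  assumes \<rho>: "density_operator n (gram n K \<Psi>)" and \<sigma>: "density_operator n \<sigma>"
    and K: "finite K" and p: "inj_on p {..<n}" "p ` {..<n} \<subseteq> K"
    and pad: "\<And>i j. i < n \<Longrightarrow> j < n \<Longrightarrow> \<Psi> i (p j) = 0"
  obtains \<Phi> where "gram n K \<Phi> = \<sigma>"
    "(\<Sum>i<n. \<Sum>k\<in>K. (cmod (\<Psi> i k - \<Phi> i k))\<^sup>2) \<le> trace_norm (gram n K \<Psi> - \<sigma>)"
proof -
  obtain U r where U: "unitary_mat n U" and Ur: "gram n K \<Psi> = diag_conj n U r"
    and r: "\<And>i. i < n \<Longrightarrow> 0 \<le> r i" using density_diagonalizable[OF \<rho>] by metis
  obtain W s where W: "unitary_mat n W" and Ws: "\<sigma> = diag_conj n W s"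
    and s: "\<And>i. i < n \<Longrightarrow> 0 \<le> s i" using density_diagonalizable[OF \<sigma>] by metis
  note Uc = unitary_matD[OF U] and Wc = unitary_matD[OF W]
  \<comment> \<open>The rows of \<Psi> in the eigenbasis of its Gram matrix: they are mutually
    orthogonal, with squared norms \<open>r i\<close>.\<close>
  define X where "X i k = (\<Sum>a<n. cnj (U $$ (a, i)) * \<Psi> a k)" for i k
  have X: "(\<Sum>k\<in>K. X i k * cnj (X j k)) = (if i = j then of_real (r i) else 0)" if "i < n" "j < n" for i j
  proof -
    have "gram n K (\<lambda>i k. \<Sum>a<n. mat_adjoint U $$ (i, a) * \<Psi> a k) = mat_diag n (\<lambda>i. complex_of_real (r i))"
      using gram_conj[of "mat_adjoint U" n K \<Psi>] Uc conj_diag_conj[OF U, of r] by (simp add: Ur)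
    from arg_cong[OF this, of "\<lambda>A. A $$ (i, j)"] show ?thesis
      using that Uc(1) by (simp add: index_gram mat_diag_def X_def)
  qed
  have Xp: "X i (p j) = 0" if "j < n" for i j
    using that pad by (simp add: X_def)
  \<comment> \<open>Nonzero rows of \<open>X\<close> are normalized. A row with eigenvalue 0 is
    replaced by the unit vector at the spare column \<open>p i\<close>, where all rows of
    \<open>X\<close> vanish, so orthonormality is preserved.\<close>
  define V where "V i k = (if r i = 0 then if k = p i then 1 else 0 else X i k / of_real (sqrt (r i)))" for i k
  have V: "(\<Sum>k\<in>K. V i k * cnj (V j k)) = (if i = j then 1 else 0)" if ij: "i < n" "j < n" for i j
  proof -
    have pK: "p i \<in> K" "p j \<in> K" using ij p by auto
    consider "r i = 0" "r j = 0" | "r i = 0" "r j \<noteq> 0" | "r i \<noteq> 0" "r j = 0" | "r i \<noteq> 0" "r j \<noteq> 0"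
      by blast
    then show ?thesis
    proof cases
      case 1
      then have "(\<Sum>k\<in>K. V i k * cnj (V j k)) = (\<Sum>k\<in>K. if k = p i then if p i = p j then 1 else 0 else 0)"
        by (intro sum.cong) (auto simp: V_def)
      then show ?thesis using K pK inj_onD[OF p(1), of i j] ij by auto
    next
      case 2
      then have "(\<Sum>k\<in>K. V i k * cnj (V j k)) = 0"
        using Xp[OF ij(1)] by (intro sum.neutral) (auto simp: V_def)
      then show ?thesis using 2 by auto
    next
      case 3
      then have "(\<Sum>k\<in>K. V i k * cnj (V j k)) = 0"
        using Xp[OF ij(2)] by (intro sum.neutral) (auto simp: V_def)
      then show ?thesis using 3 by auto
    next
      case 4
      then have "(\<Sum>k\<in>K. V i k * cnj (V j k))
        = (\<Sum>k\<in>K. X i k * cnj (X j k)) / (of_real (sqrt (r i)) * of_real (sqrt (r j)))"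
        by (simp add: V_def sum_divide_distrib)
      then show ?thesis using X[OF ij] r[OF ij(1)] 4 by (auto simp flip: of_real_mult)
    qed
  qed
  \<comment> \<open>For \<open>r i = 0\<close> the row of \<open>X\<close> has norm zero and
    vanishes, so the replacement in \<open>V\<close> is multiplied by 0.\<close>
  have XV: "X i k = of_real (sqrt (r i)) * V i k" if "i < n" "k \<in> K" for i k
  proof (cases "r i = 0")
    case True
    have "complex_of_real (\<Sum>k\<in>K. (cmod (X i k))\<^sup>2) = 0"
      using X[OF that(1,1)] True by (simp only: of_real_sum mult_cnj_cmod) simp
    then have "(\<Sum>k\<in>K. (cmod (X i k))\<^sup>2) = 0" by (simp only: of_real_eq_0_iff)
    then have "X i k = 0" using K that(2) by (simp add: sum_nonneg_eq_0_iff)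
    then show ?thesis using True by simp
  next
    case False
    then show ?thesis by (simp add: V_def)
  qed
  define R where "R = diag_conj n U (\<lambda>i. sqrt (r i))"
  define S where "S = diag_conj n W (\<lambda>i. sqrt (s i))"
  have R: "R \<in> carrier_mat n n" and S: "S \<in> carrier_mat n n" "mat_adjoint S = S"
    using Uc Wc by (simp_all add: R_def S_def mat_adjoint_diag_conj)
  have RR: "R * R = gram n K \<Psi>"
    unfolding R_def Ur diag_conj_mult[OF U] using r by (auto simp: diag_conj_def mat_diag_def intro!: arg_cong2[of _ _ _ _ "(*)"] cong_mat)
  have SS: "S * S = \<sigma>"
    unfolding S_def Ws diag_conj_mult[OF W] using s by (auto simp: diag_conj_def mat_diag_def intro!: arg_cong2[of _ _ _ _ "(*)"] cong_mat)
  \<comment> \<open>Rotating back gives the coisometry of the polar decomposition: \<Psi> is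
    \<open>R\<close> times \<open>Z\<close>, where \<open>R\<close> is the square root of its Gram
    matrix.\<close>
  define Z where "Z b k = (\<Sum>i<n. U $$ (b, i) * V i k)" for b k
  have Z: "(\<Sum>k\<in>K. Z b k * cnj (Z c k)) = (if b = c then 1 else 0)" if "b < n" "c < n" for b c
    unfolding Z_def using orthonormal_inner[OF V, where x = "\<lambda>i. U $$ (b, i)" and y = "\<lambda>i. U $$ (c, i)"]
      unitary_mat_rows[OF U that] by simp
  have \<Psi>: "\<Psi> a k = (\<Sum>b<n. R $$ (a, b) * Z b k)" if a: "a < n" and k: "k \<in> K" for a k
  proof -
    have "(\<Sum>b<n. R $$ (a, b) * Z b k) = (\<Sum>b<n. \<Sum>i<n. R $$ (a, b) * U $$ (b, i) * V i k)"
      by (simp add: Z_def sum_distrib_left mult.assoc)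
    also have "\<dots> = (\<Sum>i<n. (R * U) $$ (a, i) * V i k)"
      using R Uc(1) a by (subst sum.swap) (simp add: index_mult_mat_sum[of _ n n _ n] sum_distrib_right del: index_mult_mat(1))
    also have "R * U = U * mat_diag n (\<lambda>i. complex_of_real (sqrt (r i)))"
    proof -
      have "R * U = U * mat_diag n (\<lambda>i. complex_of_real (sqrt (r i))) * (mat_adjoint U * U)"
        using Uc(1) by (simp add: R_def diag_conj_def assoc_mult_mat[of _ n n _ n _ n] del: assoc_mult_mat)
      then show ?thesis using Uc by simp
    qed
    also have "(\<Sum>i<n. (U * mat_diag n (\<lambda>i. complex_of_real (sqrt (r i)))) $$ (a, i) * V i k)
        = (\<Sum>i<n. U $$ (a, i) * X i k)"
      using a k XV by (simp add: mat_diag_mult_right[OF Uc(1)] mult.assoc)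
    also have "\<dots> = (\<Sum>i<n. \<Sum>c<n. U $$ (a, i) * cnj (U $$ (c, i)) * \<Psi> c k)"
      by (simp add: X_def sum_distrib_left mult.assoc)
    also have "\<dots> = (\<Sum>c<n. (\<Sum>i<n. U $$ (a, i) * cnj (U $$ (c, i))) * \<Psi> c k)"
      by (subst sum.swap) (simp add: sum_distrib_right)
    also have "\<dots> = (\<Sum>c<n. (if a = c then \<Psi> c k else 0))"
      using unitary_mat_rows[OF U a] by (intro sum.cong) auto
    finally show ?thesis using a by simp
  qed
  define \<Phi> where "\<Phi> a k = (\<Sum>b<n. S $$ (a, b) * Z b k)" for a k
  have "gram n K \<Phi> = S * S"
  proof (rule eq_matI)
    fix i j assume "i < dim_row (S * S)" "j < dim_col (S * S)"
    then have ij: "i < n" "j < n" using S by auto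
    have "S $$ (b, j) = cnj (S $$ (j, b))" if "b < n" for b
      using arg_cong[OF S(2), of "\<lambda>A. A $$ (b, j)"] S(1) ij that by simp
    then show "gram n K \<Phi> $$ (i, j) = (S * S) $$ (i, j)"
      using orthonormal_inner[OF Z, where x = "\<lambda>b. S $$ (i, b)" and y = "\<lambda>b. S $$ (j, b)"] ij S
      by (simp add: index_gram \<Phi>_def index_mult_mat_sum[of _ n n _ n] del: index_mult_mat(1))
  qed (use S in auto)
  \<comment> \<open>Both factors share \<open>Z\<close>, whose rows are orthonormal, so their
    distance is that of \<open>R\<close> and \<open>S\<close>.\<close>
  moreover have "(\<Sum>i<n. \<Sum>k\<in>K. (cmod (\<Psi> i k - \<Phi> i k))\<^sup>2) = (\<Sum>i<n. \<Sum>j<n. (cmod (R $$ (i, j) - S $$ (i, j)))\<^sup>2)"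
  proof (intro sum.cong refl)
    fix i assume "i \<in> {..<n}"
    then have "(\<Sum>k\<in>K. (cmod (\<Psi> i k - \<Phi> i k))\<^sup>2) = (\<Sum>k\<in>K. (cmod (\<Sum>b<n. (R $$ (i, b) - S $$ (i, b)) * Z b k))\<^sup>2)"
      by (intro sum.cong) (auto simp: \<Psi> \<Phi>_def sum_subtractf left_diff_distrib)
    also have "\<dots> = (\<Sum>j<n. (cmod (R $$ (i, j) - S $$ (i, j)))\<^sup>2)"
      by (rule orthonormal_norm[OF Z])
    finally show "(\<Sum>k\<in>K. (cmod (\<Psi> i k - \<Phi> i k))\<^sup>2) = (\<Sum>j<n. (cmod (R $$ (i, j) - S $$ (i, j)))\<^sup>2)" .
  qed
  moreover have "\<dots> \<le> trace_norm (R * R - S * S)"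
    unfolding R_def S_def using r s by (intro powers_stormer[OF U W]) auto
  ultimately show ?thesis using that[of \<Phi>] by (simp add: RR SS)
qed

lemma gram_cong:
  "(\<And>i k. i < n \<Longrightarrow> k \<in> K \<Longrightarrow> M i k = L i k) \<Longrightarrow> gram n K M = gram n K L"
  by (rule eq_matI) (auto simp: index_gram intro!: sum.cong)

text \<open>The columns of \<open>U\<close> scaled by the roots of the eigenvalues form the factor;
  the \<open>m\<close> further zero columns are room for completing a partial isometry.\<close>

lemma density_eq_gram:
  assumes "density_operator n \<rho>"
  obtains M :: "nat \<Rightarrow> nat \<Rightarrow> complex"
  where "\<rho> = gram n {..<n + m} M" "\<And>i k. n \<le> k \<Longrightarrow> M i k = 0"
proof -
  obtain U r where U: "unitary_mat n U" and r: "\<rho> = diag_conj n U r" "\<And>i. i < n \<Longrightarrow> 0 \<le> r i"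
    using density_diagonalizable[OF assms] by metis
  define M where "M i k = (if k < n then U $$ (i, k) * of_real (sqrt (r k)) else 0)" for i k
  have "\<rho> = gram n {..<n} (\<lambda>i k. U $$ (i, k) * of_real (sqrt (r k)))"
    using r diag_conj_eq_gram[OF unitary_matD(1)[OF U]] by simp
  also have "\<dots> = gram n {..<n + m} M"
    by (rule eq_matI) (auto simp: index_gram M_def split: if_splits intro!: sum.mono_neutral_cong_left)
  finally show ?thesis by (rule that) (simp add: M_def)
qed

text \<open>A factor of the extension is regrouped to one of the marginal on AB, perturbed to a
  factor of \<sigma>, and regrouped back. The distance of the factors survives and bounds both trace
  norms.\<close>

lemma nearby_extension:
  assumes dE: "1 \<le> dE" and \<rho>: "density_operator (dA * dB * dE) \<rho>'"
    and \<sigma>: "density_operator (dA * dB) \<sigma>" and t: "t > 0"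
  defines "\<epsilon> \<equiv> trace_norm (partial_trace (dA * dB) dE 1 \<rho>' - \<sigma>) / (2 * t) + 2 * t"
  obtains \<sigma>' where "density_operator (dA * dB * dE) \<sigma>'" "partial_trace (dA * dB) dE 1 \<sigma>' = \<sigma>"
    "density_operator (dA * dE) (partial_trace dA dB dE \<rho>')"
    "density_operator (dA * dE) (partial_trace dA dB dE \<sigma>')"
    "trace_norm (\<rho>' - \<sigma>') \<le> \<epsilon>"
    "trace_norm (partial_trace dA dB dE \<rho>' - partial_trace dA dB dE \<sigma>') \<le> \<epsilon>"
proof -
  define n where "n = dA * dB"
  define N where "N = n * dE"
  define K where "K = {..<N + n}"
  define K' where "K' = {..<dE} \<times> K"
  obtain M where M: "\<rho>' = gram N K M" and M0: "\<And>i k. N \<le> k \<Longrightarrow> M i k = 0"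
    using density_eq_gram[OF \<rho>, of n] unfolding K_def N_def n_def by metis
  define \<Psi> where "\<Psi> = partial_trace_factor dE 1 M"
  have pt: "partial_trace n dE 1 (gram N K F) = gram n K' (partial_trace_factor dE 1 F)" for F
    using partial_trace_gram[of n dE 1 K F] by (simp add: N_def K'_def)
  have fr: "(\<Sum>x<n. \<Sum>k\<in>K'. g (partial_trace_factor dE 1 F x k) (partial_trace_factor dE 1 G x k))
      = (\<Sum>y<N. \<Sum>k\<in>K. g (F y k) (G y k))"
    for g :: "complex \<Rightarrow> complex \<Rightarrow> real" and F G
    using frobenius_partial_trace_factor[of g dE 1 F G K n] by (simp add: N_def K'_def)
  have M1: "(\<Sum>y<N. \<Sum>k\<in>K. (cmod (M y k))\<^sup>2) = 1"
    using density_frobenius[of N K M] \<rho> M by (simp add: N_def n_def)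
  \<comment> \<open>The spare columns pair the E-index 0, available since \<open>1 \<le> dE\<close>,
    with the \<open>n\<close> zero columns appended to \<open>M\<close> from \<open>N\<close>
    on.\<close>
  define p :: "nat \<Rightarrow> nat \<times> nat" where "p j = (0, N + j)" for j
  have d\<Psi>: "density_operator n (gram n K' \<Psi>)"
    unfolding \<Psi>_def using fr[of "\<lambda>x y. (cmod x)\<^sup>2" M M] M1 by (intro density_gram) simp
  have K': "finite K'" and p: "inj_on p {..<n}" "p ` {..<n} \<subseteq> K'"
    using dE by (auto simp: K'_def K_def p_def inj_on_def)
  have "\<Psi> i (p j) = 0" for i j
    by (simp add: \<Psi>_def partial_trace_factor_def p_def M0)
  then obtain \<Phi> where \<Phi>: "gram n K' \<Phi> = \<sigma>"
    and close: "(\<Sum>i<n. \<Sum>k\<in>K'. (cmod (\<Psi> i k - \<Phi> i k))\<^sup>2) \<le> trace_norm (gram n K' \<Psi> - \<sigma>)"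
    using gram_perturbation[OF d\<Psi> \<sigma>[folded n_def] K' p] by blast
  \<comment> \<open>The inverse regrouping: a row \<open>y\<close> of ABE splits into the AB-index
    \<open>y div dE\<close> and the E-index \<open>y mod dE\<close>.\<close>
  define L where "L y k = \<Phi> (y div dE) (y mod dE, k)" for y k
  have L\<Phi>: "partial_trace_factor dE 1 L x k = \<Phi> x k" if "k \<in> K'" for x k
    using that by (auto simp: partial_trace_factor_def L_def K'_def)
  have \<sigma>': "partial_trace n dE 1 (gram N K L) = \<sigma>"
    unfolding pt \<Phi>[symmetric] by (intro gram_cong L\<Phi>)
  have L1: "(\<Sum>y<N. \<Sum>k\<in>K. (cmod (L y k))\<^sup>2) = 1"
    using fr[of "\<lambda>x y. (cmod x)\<^sup>2" L L] density_frobenius[of n K' \<Phi>] \<sigma> \<Phi> by (simp add: L\<Phi> n_def del: One_nat_def)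
  have dist_le: "(\<Sum>y<N. \<Sum>k\<in>K. (cmod (M y k - L y k))\<^sup>2) \<le> trace_norm (partial_trace n dE 1 \<rho>' - \<sigma>)"
    using fr[of "\<lambda>x y. (cmod (x - y))\<^sup>2" M L] close by (simp add: L\<Phi> M pt \<Psi>_def del: One_nat_def)
  \<comment> \<open>Both factors have Hilbert-Schmidt norm 1, so the second term is
    \<open>2 * t\<close>.\<close>
  have \<epsilon>: "(\<Sum>y<N. \<Sum>k\<in>K. (cmod (M y k - L y k))\<^sup>2) / (2 * t)
      + t * ((\<Sum>y<N. \<Sum>k\<in>K. (cmod (M y k))\<^sup>2) + (\<Sum>y<N. \<Sum>k\<in>K. (cmod (L y k))\<^sup>2)) \<le> \<epsilon>"
    using dist_le t unfolding M1 L1 \<epsilon>_def n_def[symmetric] by (simp add: divide_right_mono)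
  have dL: "density_operator N (gram N K L)" by (rule density_gram[OF L1])
  show ?thesis
  proof (rule that[of "gram N K L"])
    show "density_operator (dA * dB * dE) (gram N K L)" using dL by (simp add: N_def n_def)
    show "partial_trace (dA * dB) dE 1 (gram N K L) = \<sigma>" using \<sigma>' by (simp add: n_def)
    show "density_operator (dA * dE) (partial_trace dA dB dE \<rho>')"
      using density_partial_trace_gram[of dA dB dE K M] \<rho> M by (simp add: N_def n_def)
    show "density_operator (dA * dE) (partial_trace dA dB dE (gram N K L))"
      using density_partial_trace_gram[of dA dB dE K L] dL by (simp add: N_def n_def)
    show "trace_norm (\<rho>' - gram N K L) \<le> \<epsilon>"
      using trace_norm_gram_diff[OF t, of N K M L] \<epsilon> unfolding M by linarith
    show "trace_norm (partial_trace dA dB dE \<rho>' - partial_trace dA dB dE (gram N K L)) \<le> \<epsilon>"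
      using trace_norm_partial_trace_gram_diff[OF t, of dA dB dE K M L] \<epsilon> unfolding M
      by (simp only: N_def n_def)
  qed
qed

text \<open>
  No boundedness is needed: on \<open>real\<close>, \<open>Inf\<close> takes one and the same junk value on all sets
  without a lower bound, and two sets within distance \<open>c\<close> of each other are both bounded or both not.
\<close>

lemma abs_Inf_diff_le:
  fixes X Y :: "real set"
  assumes X: "\<And>x. x \<in> X \<Longrightarrow> \<exists>y\<in>Y. \<bar>x - y\<bar> \<le> c" and Y: "\<And>y. y \<in> Y \<Longrightarrow> \<exists>x\<in>X. \<bar>y - x\<bar> \<le> c"
    and c: "0 \<le> c"
  shows "\<bar>Inf X - Inf Y\<bar> \<le> c"
proof -
  have bdd: "bdd_below B" if "bdd_below A" and B: "\<And>y. y \<in> B \<Longrightarrow> \<exists>x\<in>A. \<bar>y - x\<bar> \<le> c" for A B :: "real set"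
  proof -
    obtain m where m: "\<And>x. x \<in> A \<Longrightarrow> m \<le> x" using \<open>bdd_below A\<close> by (auto simp: bdd_below_def)
    have "m - c \<le> y" if y: "y \<in> B" for y
    proof -
      obtain x where "x \<in> A" "\<bar>y - x\<bar> \<le> c" using B[OF y] by blast
      then show ?thesis using m[of x] by linarith
    qed
    then show ?thesis by (rule bdd_belowI)
  qed
  have le: "Inf A - c \<le> Inf B"
    if "bdd_below A" "B \<noteq> {}" and B: "\<And>y. y \<in> B \<Longrightarrow> \<exists>x\<in>A. \<bar>y - x\<bar> \<le> c" for A B :: "real set"
  proof (rule cInf_greatest[OF \<open>B \<noteq> {}\<close>])
    fix y assume "y \<in> B"
    then obtain x where "x \<in> A" "\<bar>y - x\<bar> \<le> c" using B by blast
    then show "Inf A - c \<le> y" using cInf_lower[of x A] that(1) by linarith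
  qed
  have junk: "Inf A = - (LEAST z. False)" if "\<not> bdd_below A" for A :: "real set"
  proof -
    have "(\<lambda>z. \<forall>x\<in>uminus ` A. x \<le> z) = (\<lambda>_. False)"
    proof (rule ext)
      show "(\<forall>x\<in>uminus ` A. x \<le> z) = False" for z
        using that bdd_belowI[of A "- z"] by (auto simp: minus_le_iff)
    qed
    then show ?thesis unfolding Inf_real_def Sup_real_def by (simp only:)
  qed
  consider "X = {}" | "X \<noteq> {}" "bdd_below X" | "\<not> bdd_below X" by metis
  then show ?thesis
  proof cases
    case 1
    then have "Y = {}" using Y by blast
    then show ?thesis using 1 c by simp
  next
    case 2
    have "Y \<noteq> {}" using 2(1) X by blast
    then have "Inf X - c \<le> Inf Y" by (rule le[OF 2(2) _ Y])
    moreover have "Inf Y - c \<le> Inf X" by (rule le[OF bdd[OF 2(2) Y] 2(1) X])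
    ultimately show ?thesis by linarith
  next
    case 3
    have "\<not> bdd_below Y"
    proof
      assume "bdd_below Y"
      then have "bdd_below X" by (rule bdd) (rule X)
      with 3 show False by (rule notE)
    qed
    then show ?thesis using 3 junk c by simp
  qed
qed

section \<open>Continuity of the infimum over all extensions\<close>

theorem mainTheorem10:
  fixes f :: "real \<Rightarrow> nat \<Rightarrow> real"
  assumes f_nonneg: "\<And>\<epsilon> d. \<epsilon> \<in> {0..2} \<Longrightarrow> 1 \<le> d \<Longrightarrow> 0 \<le> f \<epsilon> d"
    and f_tendsto: "\<And>d. 1 \<le> d \<Longrightarrow> ((\<lambda>\<epsilon>. f \<epsilon> d) \<longlongrightarrow> 0) (at 0 within {0..2})"
    and f_zero: "\<And>d. 1 \<le> d \<Longrightarrow> f 0 d = 0"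
    and f_bound: "\<And>dX dY \<rho> \<sigma> \<epsilon>. \<lbrakk>1 \<le> dX; 1 \<le> dY;
        density_operator (dX * dY) \<rho>; density_operator (dX * dY) \<sigma>;
        \<epsilon> \<in> {0..2}; trace_norm (\<rho> - \<sigma>) \<le> \<epsilon>\<rbrakk>
        \<Longrightarrow> \<bar>cond_entropy dX dY \<rho> - cond_entropy dX dY \<sigma>\<bar> \<le> f \<epsilon> dX"
  shows "\<forall>dA dB. 1 \<le> dA \<longrightarrow> 1 \<le> dB \<longrightarrow>
    (\<forall>\<rho>. density_operator (dA * dB) \<rho> \<longrightarrow>
      (\<forall>\<eta>>0. \<exists>\<delta>>0. \<forall>\<sigma>. density_operator (dA * dB) \<sigma> \<longrightarrow> trace_norm (\<sigma> - \<rho>) < \<delta> \<longrightarrow>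
         \<bar>squashed_entanglement dA dB \<sigma> - squashed_entanglement dA dB \<rho>\<bar> < \<eta>))"
proof (intro allI impI)
  fix dA dB :: nat and \<rho> :: "complex mat" and \<eta> :: real
  assume dA: "1 \<le> dA" and dB: "1 \<le> dB" and \<rho>: "density_operator (dA * dB) \<rho>" and \<eta>: "0 < \<eta>"
  obtain e where e: "0 < e" "\<And>\<epsilon>. \<epsilon> \<in> {0..2} \<Longrightarrow> \<epsilon> \<noteq> 0 \<Longrightarrow> dist \<epsilon> 0 < e \<Longrightarrow> dist (f \<epsilon> dA) 0 < \<eta>"
    using tendstoD[OF f_tendsto[OF dA] \<eta>] unfolding eventually_at by blast
  \<comment> \<open>The limit is taken over punctured neighbourhoods inside \<open>{0..2}\<close>:
    the value must be positive, at most 2 and strictly below \<open>e\<close>.\<close>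
  define \<epsilon> where "\<epsilon> = min 2 (e / 2)"
  have "0 < \<epsilon>" "\<epsilon> \<in> {0..2}" "dist \<epsilon> 0 < e" using e(1) by (auto simp: \<epsilon>_def dist_real_def)
  then have \<epsilon>: "0 < \<epsilon>" "\<epsilon> \<in> {0..2}" "f \<epsilon> dA < \<eta>"
    using e(2)[of \<epsilon>] by (auto simp: dist_real_def)
  define ext where "ext \<tau> = {1/2 * cond_mutual_info dA dB dE \<rho>' | dE \<rho>'.
            1 \<le> dE \<and> density_operator (dA * dB * dE) \<rho>' \<and> partial_trace (dA * dB) dE 1 \<rho>' = \<tau>}" for \<tau>
  \<comment> \<open>The radius fits \<open>t = \<epsilon> / 4\<close> in
    \<open>nearby_extension\<close>: both summands of the resulting bound are then at most
    \<open>\<epsilon> / 2\<close>.\<close>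
  have ext_close: "\<exists>y\<in>ext \<tau>'. \<bar>x - y\<bar> \<le> f \<epsilon> dA"
    if \<tau>': "density_operator (dA * dB) \<tau>'" and near: "trace_norm (\<tau> - \<tau>') \<le> \<epsilon>\<^sup>2 / 4" and x: "x \<in> ext \<tau>" for \<tau> \<tau>' x
  proof -
    obtain dE \<omega> where dE: "1 \<le> dE" and \<omega>: "density_operator (dA * dB * dE) \<omega>"
      and \<tau>: "partial_trace (dA * dB) dE 1 \<omega> = \<tau>" and x: "x = 1/2 * cond_mutual_info dA dB dE \<omega>"
      using x unfolding ext_def by blast
    obtain \<omega>' where \<omega>': "density_operator (dA * dB * dE) \<omega>'" "partial_trace (dA * dB) dE 1 \<omega>' = \<tau>'"
      and pt: "density_operator (dA * dE) (partial_trace dA dB dE \<omega>)"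
        "density_operator (dA * dE) (partial_trace dA dB dE \<omega>')"
      and tn: "trace_norm (\<omega> - \<omega>') \<le> trace_norm (\<tau> - \<tau>') / (2 * (\<epsilon> / 4)) + 2 * (\<epsilon> / 4)"
        "trace_norm (partial_trace dA dB dE \<omega> - partial_trace dA dB dE \<omega>')
          \<le> trace_norm (\<tau> - \<tau>') / (2 * (\<epsilon> / 4)) + 2 * (\<epsilon> / 4)"
      using nearby_extension[OF dE \<omega> \<tau>', of "\<epsilon> / 4"] \<epsilon>(1) unfolding \<tau> by auto
    have "trace_norm (\<tau> - \<tau>') / (2 * (\<epsilon> / 4)) \<le> (\<epsilon>\<^sup>2 / 4) / (2 * (\<epsilon> / 4))"
      using near \<epsilon>(1) by (intro divide_right_mono) auto
    also have "\<dots> = \<epsilon> / 2" using \<epsilon>(1) by (simp add: power2_eq_square)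
    finally have le: "trace_norm (\<omega> - \<omega>') \<le> \<epsilon>"
        "trace_norm (partial_trace dA dB dE \<omega> - partial_trace dA dB dE \<omega>') \<le> \<epsilon>"
      using tn by linarith+
    have "1 \<le> dB * dE" using dB dE by simp
    then have SBE: "\<bar>cond_entropy dA (dB * dE) \<omega> - cond_entropy dA (dB * dE) \<omega>'\<bar> \<le> f \<epsilon> dA"
      using \<omega> \<omega>'(1) le(1) \<epsilon>(2) by (intro f_bound dA) (simp_all add: mult.assoc)
    have SE: "\<bar>cond_entropy dA dE (partial_trace dA dB dE \<omega>)
        - cond_entropy dA dE (partial_trace dA dB dE \<omega>')\<bar> \<le> f \<epsilon> dA"
      using pt le(2) \<epsilon>(2) by (intro f_bound dA dE)
    have "\<omega> \<in> carrier_mat (dA * dB * dE) (dA * dB * dE)" "\<omega>' \<in> carrier_mat (dA * dB * dE) (dA * dB * dE)"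
      using \<omega> \<omega>'(1) by (simp_all add: density_operator_def)
    note I = this[THEN cond_mutual_info_eq]
    \<comment> \<open>Each of the two conditional entropies contributes an error
      \<open>f \<epsilon> dA\<close>; the factor 1/2 absorbs the doubling.\<close>
    have "\<bar>x - 1/2 * cond_mutual_info dA dB dE \<omega>'\<bar> \<le> f \<epsilon> dA"
      using SBE SE unfolding x I abs_le_iff by (simp add: field_simps)
    moreover have "1/2 * cond_mutual_info dA dB dE \<omega>' \<in> ext \<tau>'"
      using dE \<omega>' unfolding ext_def by blast
    ultimately show ?thesis by blast
  qed
  have "\<bar>squashed_entanglement dA dB \<sigma> - squashed_entanglement dA dB \<rho>\<bar> < \<eta>"
    if \<sigma>: "density_operator (dA * dB) \<sigma>" and near: "trace_norm (\<sigma> - \<rho>) < \<epsilon>\<^sup>2 / 4" for \<sigma>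
  proof -
    have "trace_norm (\<rho> - \<sigma>) = trace_norm (\<sigma> - \<rho>)"
      using \<rho> \<sigma> by (intro trace_norm_minus_commute[of _ "dA * dB"]) (auto simp: density_operator_def)
    \<comment> \<open>Extensions are transported in both directions, which is why the symmetry of
      the trace distance is needed.\<close>
    then have "\<bar>Inf (ext \<sigma>) - Inf (ext \<rho>)\<bar> \<le> f \<epsilon> dA"
      using near f_nonneg[OF \<epsilon>(2) dA]
      by (intro abs_Inf_diff_le ext_close[OF \<rho>] ext_close[OF \<sigma>]) auto
    then show ?thesis using \<epsilon>(3) by (simp add: squashed_entanglement_def ext_def)
  qed
  then show "\<exists>\<delta>>0. \<forall>\<sigma>. density_operator (dA * dB) \<sigma> \<longrightarrow> trace_norm (\<sigma> - \<rho>) < \<delta> \<longrightarrow>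
      \<bar>squashed_entanglement dA dB \<sigma> - squashed_entanglement dA dB \<rho>\<bar> < \<eta>"
    using \<epsilon>(1) by (intro exI[of _ "\<epsilon>\<^sup>2 / 4"]) auto
qed

end
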